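(* Let $Y\subset\mathbb R^n$ be either (i) ($n\ge2$) a product $Y=Y_1\times\cdots\times Y_n$ of perfect subsets $Y_1,\dots,Y_n\subset\mathbb R$ such that $\mathbb Q\cap Y_k$ is dense in $Y_k$ for each $k\in\{1,2\}$, or (ii) ($n=2$) a rational Koch snowflake. Suppose that for each $k\in\mathbb N$ a non-increasing function $f_k:\mathbb R_{>0}\to\mathbb R_{>0}$ is given. Then there is a dense uncountable subset of $Y$ consisting of vectors $\mathbf{x}$ which are not algebraic and are $f_k$-uniform of degree $k$ for all $k\in\mathbb N$; in particular $Y$ contains a dense uncountable set of non-algebraic $\mathbf{x}$ which are $k$-singular for all $k\in\mathbb N$.
   Context: A rational Koch snowflake: let $\alpha,\beta,\gamma,\delta$ be positive rationals with $\alpha<\beta<\delta<1$; put $\mathbf{x}_1=(0,0)$, $\mathbf{y}_1=(\alpha,0)$, $\mathbf{x}_2=\mathbf{y}_1$, $\mathbf{y}_2=(\beta,\gamma)$, $\mathbf{x}_3=\mathbf{y}_2$, $\mathbf{y}_3=(\delta,0)$, $\mathbf{x}_4=\mathbf{y}_3$, $\mathbf{y}_4=(1,0)$, and let $\varphi_i:\mathbb R^2\to\mathbb R^2$ be the unique orientation-preserving contracting similarity sending $(0,0)\mapsto\mathbf{x}_i$ and $(1,0)\mapsto\mathbf{y}_i$; the snowflake is the attractor of the iterated function system $\{\varphi_1,\dots,\varphi_4\}$. For $P\in\mathbb Z[X_1,\dots,X_n]$, $H(P)$ is the maximum absolute value of its coefficients. For non-increasing $f$, $\mathbf{x}\in\mathbb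 R^n$ is $f$-uniform of degree $k$ if for every sufficiently large $t$ there is a nonzero $P\in\mathbb Z[X_1,\dots,X_n]$ with $\deg P\le k$, $H(P)\le t$, $|P(\mathbf{x})|\le f(t)$. With $N(k,n)=\binom{k+n}{n}-1$, $\mathbf{x}$ is $k$-singular if for every $\varepsilon>0$ it is $f$-uniform of degree $k$ for $f(t)=\varepsilon t^{-N(k,n)}$. $\mathbf{x}$ is algebraic if $P(\mathbf{x})=0$ for some nonzero $P\in\mathbb Z[X_1,\dots,X_n]$. *)

theory Defs
  imports "HOL-Analysis.Analysis" "HOL-Library.Poly_Mapping"
begin

text \<open>
  Elements of \<open>\<int>[X\<^sub>i : i \<in> 'n]\<close>, as finitely supported maps from exponent vectors to coefficients.
\<close>

type_synonym 'n int_mpoly = "('n \<Rightarrow>\<^sub>0 nat) \<Rightarrow>\<^sub>0 int"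

definition eval_mpoly :: "'n::finite int_mpoly \<Rightarrow> real ^ 'n \<Rightarrow> real" where
  "eval_mpoly P x =
     (\<Sum>m\<in>Poly_Mapping.keys P.
        of_int (Poly_Mapping.lookup P m) * (\<Prod>i\<in>UNIV. (x $ i) ^ Poly_Mapping.lookup m i))"

text \<open>The total degree; the zero polynomial gets degree \<open>0\<close>.\<close>

definition total_degree :: "'n::finite int_mpoly \<Rightarrow> nat" where
  "total_degree P =
     Max (insert 0 ((\<lambda>m. \<Sum>i\<in>UNIV. Poly_Mapping.lookup m i) ` Poly_Mapping.keys P))"

definition height :: "'n int_mpoly \<Rightarrow> int" where
  "height P = Max (insert 0 ((\<lambda>m. \<bar>Poly_Mapping.lookup P m\<bar>) ` Poly_Mapping.keys P))"

definition algebraic_vector :: "real ^ 'n::finite \<Rightarrow> bool" where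
  "algebraic_vector x \<longleftrightarrow> (\<exists>P :: 'n int_mpoly. P \<noteq> 0 \<and> eval_mpoly P x = 0)"

definition uniform_of_degree :: "(real \<Rightarrow> real) \<Rightarrow> nat \<Rightarrow> real ^ 'n::finite \<Rightarrow> bool" where
  "uniform_of_degree f k x \<longleftrightarrow>
     (\<forall>\<^sub>F t in at_top. \<exists>P :: 'n int_mpoly.
        P \<noteq> 0 \<and> total_degree P \<le> k \<and> real_of_int (height P) \<le> t \<and> \<bar>eval_mpoly P x\<bar> \<le> f t)"

definition singular_of_degree :: "nat \<Rightarrow> real ^ 'n::finite \<Rightarrow> bool" where
  "singular_of_degree k x \<longleftrightarrow>
     (\<forall>\<epsilon>>0. uniform_of_degree
        (\<lambda>t. \<epsilon> * t powr - real (((k + CARD('n)) choose CARD('n)) - 1)) k x)"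

definition perfect_set :: "'a::topological_space set \<Rightarrow> bool" where
  "perfect_set S \<longleftrightarrow> closed S \<and> (\<forall>x\<in>S. x islimpt S)"

definition contracting_similarity :: "('a::metric_space \<Rightarrow> 'a) \<Rightarrow> bool" where
  "contracting_similarity \<phi> \<longleftrightarrow>
     (\<exists>r. 0 < r \<and> r < 1 \<and> (\<forall>p q. dist (\<phi> p) (\<phi> q) = r * dist p q))"

text \<open>
  Only meant for affine maps; every similarity of \<open>\<real>\<^sup>n\<close> is affine.
\<close>

definition orientation_preserving :: "(real ^ 'n::finite \<Rightarrow> real ^ 'n) \<Rightarrow> bool" where
  "orientation_preserving \<phi> \<longleftrightarrow> (\<exists>A c. (\<forall>p. \<phi> p = A *v p + c) \<and> det A > 0)"

definition is_attractor :: "'i set \<Rightarrow> ('i \<Rightarrow> 'a::metric_space \<Rightarrow> 'a) \<Rightarrow> 'a set \<Rightarrow> bool" where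
  "is_attractor I \<phi> Y \<longleftrightarrow> compact Y \<and> Y \<noteq> {} \<and> Y = (\<Union>i\<in>I. \<phi> i ` Y)"

definition koch_vertices :: "real \<Rightarrow> real \<Rightarrow> real \<Rightarrow> real \<Rightarrow> (real ^ 2) list" where
  "koch_vertices \<alpha> \<beta> \<gamma> \<delta> =
     [vector [0, 0], vector [\<alpha>, 0], vector [\<beta>, \<gamma>], vector [\<delta>, 0], vector [1, 0]]"

text \<open>
  The generating maps are indexed from \<open>0\<close>: \<open>\<phi> i\<close> sends the unit segment to the segment joining
  the consecutive vertices \<open>i\<close> and \<open>i + 1\<close>.  Such a contraction exists only if that segment is
  shorter than \<open>1\<close>; parameters violating this (\<open>\<gamma>\<close> too large) give no snowflake.
\<close>

definition rational_koch_snowflake :: "(real ^ 2) set \<Rightarrow> bool" where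
  "rational_koch_snowflake Y \<longleftrightarrow>
     (\<exists>\<alpha>\<in>\<rat>. \<exists>\<beta>\<in>\<rat>. \<exists>\<gamma>\<in>\<rat>. \<exists>\<delta>\<in>\<rat>.
        0 < \<alpha> \<and> \<alpha> < \<beta> \<and> \<beta> < \<delta> \<and> \<delta> < 1 \<and> 0 < \<gamma> \<and>
        (\<exists>\<phi> :: nat \<Rightarrow> real ^ 2 \<Rightarrow> real ^ 2.
           (\<forall>i<4. contracting_similarity (\<phi> i) \<and> orientation_preserving (\<phi> i) \<and>
              \<phi> i (vector [0, 0]) = koch_vertices \<alpha> \<beta> \<gamma> \<delta> ! i \<and>
              \<phi> i (vector [1, 0]) = koch_vertices \<alpha> \<beta> \<gamma> \<delta> ! Suc i) \<and>
           is_attractor {..<4} \<phi> Y))"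

definition has_dense_uncountable_subset :: "'a::topological_space set \<Rightarrow> ('a \<Rightarrow> bool) \<Rightarrow> bool" where
  "has_dense_uncountable_subset Y Q \<longleftrightarrow>
     (\<exists>D. D \<subseteq> Y \<and> Y \<subseteq> closure D \<and> uncountable D \<and> (\<forall>x\<in>D. Q x))"

end

theory Submission
  imports Defs "HOL-Computational_Algebra.Polynomial"
begin

text \<open>
  Linear polynomials suffice. Suppose \<open>Y\<close> contains densely many subsets of rational hyperplanes
  such that every relatively open part of one of them meets another one. Choose nested balls
  \<open>V\<^sub>0 \<supseteq> V\<^sub>1 \<supseteq> \<dots>\<close>, each meeting one of these subsets, and integer polynomials
  \<open>P\<^sub>m\<close> of degree \<open>1\<close> and height at least \<open>m\<close> vanishing on the subset met by \<open>V\<^sub>m\<close>.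
  Before shrinking to \<open>V\<^sub>m\<^sub>+\<^sub>1\<close> one already knows \<open>P\<^sub>m\<^sub>+\<^sub>1\<close>, so \<open>V\<^sub>m\<^sub>+\<^sub>1\<close> can be placed
  around a point of both hyperplanes where \<open>\<bar>P\<^sub>m\<bar> \<le> f\<^sub>k (H(P\<^sub>m\<^sub>+\<^sub>1))\<close> for all \<open>k \<le> m\<close>; the limit point is then
  \<open>f\<^sub>k\<close>-uniform for every \<open>k\<close>. At each step one can also avoid the zero set of a prescribed nonzero polynomial.
  Doing so for the integer polynomials excludes algebraic points, and doing so for \<open>x \<mapsto> \<bar>x - d\<bar>\<^sup>2\<close> with
  \<open>d\<close> in a given countable set shows that the set of limit points is uncountable.
\<close>

section \<open>Zero sets of polynomials\<close>

lemma real_polynomial_function_on_line: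
  assumes "real_polynomial_function g"
  obtains p :: "real poly" where "\<And>t. g (x + t *\<^sub>R v) = poly p t"
proof -
  have "\<exists>p :: real poly. \<forall>t. g (x + t *\<^sub>R v) = poly p t"
    using assms
  proof induction
    case (linear f)
    then interpret bounded_linear f .
    show ?case by (intro exI[of _ "[:f x, f v:]"]) (simp add: add scaleR)
  next
    case (const c)
    show ?case by (intro exI[of _ "[:c:]"]) simp
  next
    case (add f g)
    then show ?case by (metis poly_add)
  next
    case (mult f g)
    then show ?case by (metis poly_mult)
  qed
  then show ?thesis using that by blast
qed

lemma real_polynomial_function_zero_on_line:
  assumes "real_polynomial_function g"
    and "infinite T" "\<And>t. t \<in> T \<Longrightarrow> g (x + t *\<^sub>R v) = 0"
  shows "g (x + s *\<^sub>R v) = 0"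
proof -
  obtain p where p: "\<And>t. g (x + t *\<^sub>R v) = poly p t"
    using real_polynomial_function_on_line[OF assms(1)] by metis
  have "T \<subseteq> {t. poly p t = 0}"
    using assms(3) p by auto
  then have "p = 0"
    using assms(2) poly_roots_finite finite_subset by blast
  then show ?thesis by (simp add: p)
qed

lemma real_polynomial_function_zero_on_box:
  fixes g :: "real ^ 'n::finite \<Rightarrow> real"
  assumes g: "real_polynomial_function g" and fin: "finite A"
    and inf: "\<And>l. l \<in> A \<Longrightarrow> infinite (S l)"
    and zero: "\<And>x. (\<And>l. l \<in> A \<Longrightarrow> x $ l \<in> S l) \<Longrightarrow> (\<And>l. l \<notin> A \<Longrightarrow> x $ l = z $ l) \<Longrightarrow> g x = 0"
    and x: "\<And>l. l \<notin> A \<Longrightarrow> x $ l = z $ l"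
  shows "g x = 0"
  using fin inf zero x
proof (induction A arbitrary: z x)
  case empty
  then show ?case by simp
next
  case (insert a A)
  have "g (x + t *\<^sub>R axis a 1) = 0" if "t \<in> (\<lambda>s. s - x $ a) ` S a" for t
  proof (rule insert.IH)
    \<comment> \<open>This is \<open>z\<close> with coordinate \<open>a\<close> reset to
      \<open>x $ a + t\<close>, a value in \<open>S a\<close>; coordinate \<open>a\<close> now
      counts as frozen.\<close>
    define z' where "z' = z + (x $ a + t - z $ a) *\<^sub>R axis a 1"
    show "infinite (S l)" if "l \<in> A" for l
      using insert.prems that by blast
    show "g y = 0" if "\<And>l. l \<in> A \<Longrightarrow> y $ l \<in> S l" "\<And>l. l \<notin> A \<Longrightarrow> y $ l = z' $ l" for y
      using that insert.hyps \<open>t \<in> _\<close>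
      by (intro insert.prems) (auto simp: z'_def axis_def)
    show "(x + t *\<^sub>R axis a 1) $ l = z' $ l" if "l \<notin> A" for l
      using that insert.prems(3)[of l] by (auto simp: z'_def axis_def)
  qed
  moreover have "infinite ((\<lambda>s. s - x $ a) ` S a)"
    using insert.prems(1)[of a] by (subst finite_image_iff) (auto simp: inj_on_def)
  ultimately show ?case
    using real_polynomial_function_zero_on_line[OF g, of _ x "axis a 1" 0] by simp
qed

section \<open>Integer polynomials as functions\<close>

lemma real_polynomial_function_component [intro]:
  "real_polynomial_function (\<lambda>x :: real ^ 'n::finite. x $ i)"
  by (simp add: bounded_linear_vec_nth real_polynomial_function.intros(1))

lemma real_polynomial_function_eval_mpoly:
  "real_polynomial_function (eval_mpoly P)"
  unfolding eval_mpoly_def[abs_def]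
  by (intro real_polynomial_function_sum real_polynomial_function.intros(2,4)
      real_polynomial_function_prod real_polynomial_function_power
      real_polynomial_function_component finite_keys) simp_all

text \<open>Kronecker substitution: the weights are digits' place values in a sufficiently large base.\<close>

lemma separating_weights:
  fixes K :: "('n \<Rightarrow> nat) set"
  assumes "finite A" "finite K"
  shows "\<exists>w. \<forall>m\<in>K. \<forall>m'\<in>K. (\<Sum>i\<in>A. m i * w i) = (\<Sum>i\<in>A. m' i * w i) \<longrightarrow> (\<forall>i\<in>A. m i = m' i)"
  using assms(1)
proof induction
  case empty
  then show ?case by simp
next
  case (insert a A)
  then obtain w where w: "\<And>m m'. m \<in> K \<Longrightarrow> m' \<in> K \<Longrightarrow>
      (\<Sum>i\<in>A. m i * w i) = (\<Sum>i\<in>A. m' i * w i) \<Longrightarrow> \<forall>i\<in>A. m i = m' i"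
    by blast
  define N where "N = Suc (Max ((\<lambda>m. m a) ` K))"
  have N: "m a < N" if "m \<in> K" for m
    using that assms(2) by (auto simp: N_def less_Suc_eq_le)
  \<comment> \<open>The exponent of \<open>a\<close> becomes the units digit in base
    \<open>N\<close>, and the old weighted sum moves up by one place.\<close>
  define w' where "w' i = (if i = a then 1 else N * w i)" for i
  have sum: "(\<Sum>i\<in>insert a A. m i * w' i) = m a + N * (\<Sum>i\<in>A. m i * w i)" for m
  proof -
    have "(\<Sum>i\<in>A. m i * w' i) = N * (\<Sum>i\<in>A. m i * w i)"
      unfolding sum_distrib_left using insert.hyps
      by (intro sum.cong) (auto simp: w'_def)
    then show ?thesis using insert.hyps by (simp add: w'_def)
  qed
  have "\<forall>i\<in>insert a A. m i = m' i"
    if m: "m \<in> K" "m' \<in> K" and eq: "(\<Sum>i\<in>insert a A. m i * w' i) = (\<Sum>i\<in>insert a A. m' i * w' i)"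
    for m m'
  proof -
    let ?q = "\<Sum>i\<in>A. m i * w i" and ?q' = "\<Sum>i\<in>A. m' i * w i"
    have *: "m a + N * ?q = m' a + N * ?q'"
      using eq by (simp only: sum)
    have "(m a + N * ?q) mod N = m a" "(m' a + N * ?q') mod N = m' a"
      using N m by auto
    with * have "m a = m' a" by metis
    moreover from this * have "?q = ?q'"
      using N[OF m(1)] by auto
    ultimately show ?thesis using w[OF m] by blast
  qed
  then show ?case by blast
qed

text \<open>On the curve with coordinates \<open>t ^ w i\<close>, separating weights turn distinct
  monomials of \<open>P\<close> into distinct powers of \<open>t\<close>, so no coefficient can
  cancel in the resulting univariate polynomial.\<close>

lemma eval_mpoly_not_identically_zero:
  fixes P :: "'n::finite int_mpoly"
  assumes "P \<noteq> 0"
  shows "\<exists>x. eval_mpoly P x \<noteq> 0"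
proof (rule ccontr)
  assume "\<not> ?thesis"
  then have zero: "eval_mpoly P x = 0" for x by blast
  let ?K = "Poly_Mapping.keys P"
  obtain w where w: "\<forall>m\<in>Poly_Mapping.lookup ` ?K. \<forall>m'\<in>Poly_Mapping.lookup ` ?K.
      (\<Sum>i\<in>UNIV. m i * w i) = (\<Sum>i\<in>UNIV. m' i * w i) \<longrightarrow> (\<forall>i\<in>UNIV. m i = m' i)"
    using separating_weights[of UNIV "Poly_Mapping.lookup ` ?K"] by auto
  define e where "e m = (\<Sum>i\<in>UNIV. Poly_Mapping.lookup m i * w i)" for m
  have e: "m = m'" if "m \<in> ?K" "m' \<in> ?K" "e m = e m'" for m m'
  proof (rule poly_mapping_eqI)
    show "Poly_Mapping.lookup m i = Poly_Mapping.lookup m' i" for i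
      using w[rule_format, OF imageI imageI, OF that(1,2) that(3)[unfolded e_def]] by simp
  qed
  define p where "p = (\<Sum>m\<in>?K. monom (real_of_int (Poly_Mapping.lookup P m)) (e m))"
  have "poly p t = eval_mpoly P (\<chi> i. t ^ w i)" for t
    unfolding p_def eval_mpoly_def e_def
    by (simp add: poly_sum poly_monom power_sum power_mult mult.commute)
  then have "p = 0"
    using poly_all_0_iff_0 zero by metis
  obtain m where m: "m \<in> ?K"
    using assms by (metis all_not_in_conv keys_eq_empty)
  have "coeff p (e m) = (\<Sum>m'\<in>?K. if m' = m then real_of_int (Poly_Mapping.lookup P m') else 0)"
    unfolding p_def coeff_sum coeff_monom using m by (intro sum.cong) (auto dest: e)
  also have "\<dots> = real_of_int (Poly_Mapping.lookup P m)"
    using m by simp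
  finally show False
    using m \<open>p = 0\<close> by (simp add: in_keys_iff)
qed

text \<open>A polynomial is encoded by the finite graph of its coefficient function on the support;
  a countable type has only countably many finite subsets.\<close>

lemma countable_int_mpoly: "countable (UNIV :: 'n::finite int_mpoly set)"
proof -
  define c :: "'n int_mpoly \<Rightarrow> (('n \<Rightarrow> nat) \<times> int) set" where
    "c P = (\<lambda>m. (Poly_Mapping.lookup m, Poly_Mapping.lookup P m)) ` Poly_Mapping.keys P" for P
  have mem: "(Poly_Mapping.lookup m, a) \<in> c P \<longleftrightarrow> a = Poly_Mapping.lookup P m \<and> a \<noteq> 0" for P m a
    by (auto simp: c_def in_keys_iff)
  have "inj c"
  proof (rule injI, rule poly_mapping_eqI)
    fix P Q m assume "c P = c Q"
    then show "Poly_Mapping.lookup P m = Poly_Mapping.lookup Q m"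
      using mem[of m _ P] mem[of m _ Q] by metis
  qed
  moreover have "range c \<subseteq> Collect finite"
    by (auto simp: c_def)
  then have "countable (range c)"
    using countable_Collect_finite countable_subset by blast
  ultimately show ?thesis
    by (simp add: countable_image_inj_eq)
qed

text \<open>Supports change under addition; a common finite index set makes the sums
  comparable.\<close>

lemma eval_mpoly_superset:
  assumes "finite A" "Poly_Mapping.keys P \<subseteq> A"
  shows "eval_mpoly P x = (\<Sum>m\<in>A. of_int (Poly_Mapping.lookup P m) *
    (\<Prod>i\<in>UNIV. (x $ i) ^ Poly_Mapping.lookup m i))"
  unfolding eval_mpoly_def using assms
  by (intro sum.mono_neutral_left) (auto simp: in_keys_iff)

lemma eval_mpoly_add: "eval_mpoly (P + Q) x = eval_mpoly P x + eval_mpoly Q x"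
proof -
  let ?A = "Poly_Mapping.keys P \<union> Poly_Mapping.keys Q"
  show ?thesis
    using keys_add[of P Q]
    by (simp add: eval_mpoly_superset[of ?A] lookup_add algebra_simps sum.distrib)
qed

lemma eval_mpoly_sum: "eval_mpoly (sum P I) x = (\<Sum>i\<in>I. eval_mpoly (P i) x)"
  by (induction I rule: infinite_finite_induct) (simp_all add: eval_mpoly_add, simp_all add: eval_mpoly_def)

lemma eval_mpoly_single:
  "eval_mpoly (Poly_Mapping.single m c) x = of_int c * (\<Prod>i\<in>UNIV. (x $ i) ^ Poly_Mapping.lookup m i)"
  by (simp add: eval_mpoly_superset[of "{m}"])

lemma eval_mpoly_single_variable:
  fixes x :: "real ^ 'n::finite"
  shows "eval_mpoly (Poly_Mapping.single (Poly_Mapping.single i 1) c) x = of_int c * x $ i"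
proof -
  have "(\<Prod>j\<in>UNIV. (x $ j) ^ Poly_Mapping.lookup (Poly_Mapping.single i 1) j)
      = (\<Prod>j\<in>UNIV. if j = i then x $ j else 1)"
    by (intro prod.cong) (auto simp: lookup_single when_def)
  also have "\<dots> = x $ i"
    by simp
  finally show ?thesis
    by (simp add: eval_mpoly_single)
qed

lemma common_denominator:
  assumes "finite F" "F \<subseteq> (\<rat> :: real set)"
  shows "\<exists>M::nat. M > 0 \<and> (\<forall>x\<in>F. real M * x \<in> \<int>)"
  using assms
proof induction
  case empty
  then show ?case by (intro exI[of _ 1]) simp
next
  case (insert a F)
  then obtain M where M: "M > 0" "\<And>x. x \<in> F \<Longrightarrow> real M * x \<in> \<int>" by auto
  obtain p q where q: "q > 0" "a = of_int p / of_int q"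
    using insert.prems Rats_cases'[of a] by (metis insert_subset)
  define q' where "q' = nat q"
  have q': "q' > 0" "a = of_int p / real q'" using q by (auto simp: q'_def)
  have "real (M * q') * a = of_int (int M * p)"
    using q' by simp
  moreover have "real (M * q') * x = real q' * (real M * x)" for x
    by simp
  ultimately have "\<forall>x\<in>insert a F. real (M * q') * x \<in> \<int>"
    using M(2) by (metis Ints_mult Ints_of_int Ints_of_nat insertE)
  then show ?case
    using M(1) q'(1) by (intro exI[of _ "M * q'"]) auto
qed

text \<open>Clearing denominators in the equation of the hyperplane gives an integer polynomial; a
  further integer factor raises the height at will without changing the zero set.\<close>

lemma linear_mpoly_on_rational_hyperplane:
  fixes a :: "real ^ 'n::finite"
  assumes a: "\<And>i. a $ i \<in> \<rat>" "a \<noteq> 0" and c: "c \<in> \<rat>"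
  shows "\<exists>P :: 'n int_mpoly. P \<noteq> 0 \<and> total_degree P \<le> 1 \<and> height P \<ge> int N \<and>
    (\<forall>x. a \<bullet> x = c \<longrightarrow> eval_mpoly P x = 0)"
proof -
  obtain M where M: "M > 0" "\<And>x. x \<in> insert c (range (($) a)) \<Longrightarrow> real M * x \<in> \<int>"
    using common_denominator[of "insert c (range (($) a))"] a(1) c by auto
  have "\<exists>b. real M * a $ i = of_int b" for i
    using M(2)[of "a $ i"] by (auto simp: Ints_def)
  then obtain b where b: "\<And>i. real M * a $ i = of_int (b i)"
    by metis
  obtain d where d: "real M * c = of_int d"
    using M(2)[of c] unfolding Ints_def by auto
  obtain l where l: "a $ l \<noteq> 0"
    using a(2) by (auto simp: vec_eq_iff)
  have bl: "b l \<noteq> 0"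
    using b[of l] l M(1) by auto
  define X :: "'n \<Rightarrow> 'n \<Rightarrow>\<^sub>0 nat" where "X i = Poly_Mapping.single i 1" for i
  have X: "X i = X j \<longleftrightarrow> i = j" "X i \<noteq> 0" for i j
    by (metis X_def lookup_single_eq lookup_single_not_eq one_neq_zero,
        metis X_def lookup_single_eq lookup_zero one_neq_zero)
  \<comment> \<open>The successor keeps the factor positive even for \<open>N = 0\<close>.\<close>
  define K where "K = int (Suc N)"
  define P :: "'n int_mpoly" where
    "P = Poly_Mapping.single 0 (- K * d) + (\<Sum>i\<in>UNIV. Poly_Mapping.single (X i) (K * b i))"
  \<comment> \<open>A single coefficient, at a coordinate where \<open>a\<close> does not vanish,
    witnesses both \<open>P \<noteq> 0\<close> and the height bound.\<close>
  have "Poly_Mapping.lookup P (X l) = (\<Sum>i\<in>UNIV. if i = l then K * b i else 0)"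
    unfolding P_def lookup_add lookup_sum using X by (auto simp: lookup_single when_def)
  then have lookup: "Poly_Mapping.lookup P (X l) = K * b l"
    by simp
  with bl have l_key: "X l \<in> Poly_Mapping.keys P"
    by (simp add: in_keys_iff K_def)
  have keys: "Poly_Mapping.keys P \<subseteq> insert 0 (range X)"
    unfolding P_def
    by (intro order.trans[OF keys_add] Un_least order.trans[OF keys_sum]) (auto split: if_splits)
  have "(\<Sum>i\<in>UNIV. Poly_Mapping.lookup (X j) i) = 1" for j
    by (simp add: X_def lookup_single when_def)
  then have "(\<Sum>i\<in>UNIV. Poly_Mapping.lookup m i) \<le> 1" if "m \<in> Poly_Mapping.keys P" for m
    using that keys by (cases "m = 0") auto
  then have "total_degree P \<le> 1"
    unfolding total_degree_def by (intro Max.boundedI) auto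
  moreover have "\<bar>K * b l\<bar> \<le> height P"
    unfolding height_def lookup[symmetric] using l_key by (intro Max_ge) auto
  then have "int N \<le> height P"
  proof -
    have "K * 1 \<le> K * \<bar>b l\<bar>"
      using bl by (intro mult_left_mono) (auto simp: K_def)
    also have "\<dots> \<le> height P"
      using \<open>\<bar>K * b l\<bar> \<le> height P\<close> by (simp add: K_def abs_mult)
    finally show ?thesis
      by (simp add: K_def)
  qed
  moreover have "eval_mpoly P x = real_of_int K * real M * (a \<bullet> x - c)" for x
  proof -
    have "eval_mpoly P x = (\<Sum>i\<in>UNIV. real_of_int (K * b i) * x $ i) - real_of_int (K * d)"
      unfolding P_def X_def eval_mpoly_add eval_mpoly_sum eval_mpoly_single_variable
      by (simp add: eval_mpoly_single)
    also have "(\<Sum>i\<in>UNIV. real_of_int (K * b i) * x $ i) = real_of_int K * real M * (a \<bullet> x)"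
      unfolding inner_vec_def sum_distrib_left of_int_mult b[symmetric]
      by (intro sum.cong) simp_all
    finally show ?thesis
      by (simp add: d[symmetric] algebra_simps)
  qed
  moreover have "P \<noteq> 0"
    using l_key by auto
  ultimately show ?thesis
    by (intro exI[of _ P]) auto
qed

section \<open>Hyperplane families\<close>

definition rational_hyperplane :: "(real ^ 'n::finite) set \<Rightarrow> bool" where
  "rational_hyperplane L \<longleftrightarrow>
     (\<exists>a c. (\<forall>i. a $ i \<in> \<rat>) \<and> a \<noteq> 0 \<and> c \<in> \<rat> \<and> L = {x. a \<bullet> x = c})"

text \<open>For continuous \<open>g\<close> the zero set is relatively closed in \<open>C\<close>,
  so nowhere density there amounts to empty relative interior.\<close>

definition zeros_nowhere_dense_in :: "('a::real_normed_vector \<Rightarrow> real) \<Rightarrow> 'a set \<Rightarrow> bool" where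
  "zeros_nowhere_dense_in g C \<longleftrightarrow> (\<forall>V. open V \<and> V \<inter> C \<noteq> {} \<longrightarrow> (\<exists>y\<in>V \<inter> C. g y \<noteq> 0))"

text \<open>This is the property shared by products and snowflakes. The next member
  \<open>C'\<close> may depend on the polynomial \<open>g\<close> to be avoided: it has to cross
  \<open>C\<close> inside \<open>U\<close> without lying, even locally, in the zero set of
  \<open>g\<close>.\<close>

definition hyperplane_family :: "(real ^ 'n::finite) set \<Rightarrow> (real ^ 'n) set set \<Rightarrow> bool" where
  "hyperplane_family Y \<C> \<longleftrightarrow>
     (\<forall>C\<in>\<C>. C \<subseteq> Y \<and> (\<exists>L. rational_hyperplane L \<and> C \<subseteq> L)) \<and>
     (\<forall>C\<in>\<C>. \<forall>U g. open U \<and> U \<inter> C \<noteq> {} \<and> real_polynomial_function g \<and> (\<exists>x. g x \<noteq> 0) \<longrightarrow>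
        (\<exists>C'\<in>\<C>. U \<inter> C \<inter> C' \<noteq> {} \<and> zeros_nowhere_dense_in g C'))"

section \<open>Nested neighbourhoods and their limit points\<close>

lemma continuous_real_polynomial_on:
  "real_polynomial_function g \<Longrightarrow> continuous_on UNIV g"
  for g :: "'a::euclidean_space \<Rightarrow> real"
  using continuous_on_polymonial_function real_polynomial_function_eq by blast

lemma mpoly_vanishing_on_family_member:
  fixes C :: "(real ^ 'n::finite) set"
  assumes "hyperplane_family Y \<C>" "C \<in> \<C>"
  shows "\<exists>P :: 'n int_mpoly. P \<noteq> 0 \<and> total_degree P \<le> 1 \<and> height P \<ge> int N \<and>
    (\<forall>x\<in>C. eval_mpoly P x = 0)"
proof -
  obtain L where "rational_hyperplane L" "C \<subseteq> L"
    using assms by (auto simp: hyperplane_family_def)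
  then obtain a c where *: "\<And>i. a $ i \<in> \<rat>" "a \<noteq> 0" "c \<in> \<rat>" "C \<subseteq> {x. a \<bullet> x = c}"
    by (auto simp: rational_hyperplane_def)
  then show ?thesis
    using linear_mpoly_on_rational_hyperplane[OF *(1-3), of N] by blast
qed

text \<open>At a common point of \<open>C\<close> and \<open>C'\<close> the value of
  \<open>P\<close> is \<open>0\<close>, so \<open>P\<close> is small on a neighbourhood that still
  meets \<open>C'\<close>. Inside it some point of \<open>C'\<close> is not a zero of
  \<open>g\<close>, and a small ball around that point serves as \<open>W\<close>.\<close>

lemma shrink_avoiding:
  fixes V :: "(real ^ 'n::finite) set" and P :: "'n int_mpoly"
  assumes V: "open V" "V \<inter> C \<inter> C' \<noteq> {}" and P: "\<And>x. x \<in> C \<Longrightarrow> eval_mpoly P x = 0"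
    and g: "real_polynomial_function g" "zeros_nowhere_dense_in g C'" and "\<delta> > 0"
  shows "\<exists>W. open W \<and> W \<inter> C' \<noteq> {} \<and> compact (closure W) \<and> closure W \<subseteq> V \<and>
    (\<forall>x\<in>W. \<bar>eval_mpoly P x\<bar> < \<delta> \<and> g x \<noteq> 0)"
proof -
  have cont: "continuous_on UNIV (\<lambda>x. \<bar>eval_mpoly P x\<bar>)" "continuous_on UNIV g"
    using g(1)
    by (intro continuous_intros continuous_real_polynomial_on real_polynomial_function_eval_mpoly, simp)+
  define U where "U = V \<inter> {x. \<bar>eval_mpoly P x\<bar> < \<delta>}"
  have "open U"
    unfolding U_def using V(1) cont(1) by (intro open_Int open_Collect_less) auto
  moreover have "U \<inter> C' \<noteq> {}"
    using V(2) P \<open>\<delta> > 0\<close> by (auto simp: U_def)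
  ultimately obtain y where y: "y \<in> U" "y \<in> C'" "g y \<noteq> 0"
    using g(2) unfolding zeros_nowhere_dense_in_def by blast
  have "open (U \<inter> {x. g x \<noteq> 0})"
    using \<open>open U\<close> cont(2) by (intro open_Int open_Collect_neq) auto
  then obtain r where r: "r > 0" "cball y r \<subseteq> U \<inter> {x. g x \<noteq> 0}"
    using y open_contains_cball[THEN iffD1, rule_format, of "U \<inter> {x. g x \<noteq> 0}" y] by auto
  show ?thesis
  proof (intro exI conjI)
    show "ball y r \<inter> C' \<noteq> {}"
      using y(2) r(1) centre_in_ball[of y r] by blast
    show "compact (closure (ball y r))" "closure (ball y r) \<subseteq> V"
      using r by (auto simp: U_def)
    show "\<forall>x\<in>ball y r. \<bar>eval_mpoly P x\<bar> < \<delta> \<and> g x \<noteq> 0"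
      using order.trans[OF ball_subset_cball r(2)] unfolding U_def by blast
  qed simp
qed

text \<open>For given \<open>t\<close> one picks consecutive polynomials whose heights enclose
  \<open>t\<close>. The value of the first is at most \<open>f\<close> at the height of the second,
  hence at most \<open>f t\<close> because \<open>f\<close> is non-increasing.\<close>

lemma uniform_of_degreeI:
  fixes P :: "nat \<Rightarrow> 'n::finite int_mpoly"
  assumes P: "\<And>m. P m \<noteq> 0" "\<And>m. total_degree (P m) \<le> 1" "\<And>m. height (P m) \<ge> int m"
    and small: "\<And>m. m \<ge> k \<Longrightarrow> \<bar>eval_mpoly (P m) x\<bar> \<le> f (height (P (Suc m)))"
    and noninc: "antimono_on {0<..} f" and k: "k \<ge> 1"
  shows "uniform_of_degree f k x"
  unfolding uniform_of_degree_def
proof (rule eventually_at_top_linorderI)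
  \<comment> \<open>The bound \<open>1\<close> puts \<open>t\<close> where \<open>f\<close> is known
    to be non-increasing; the heights up to index \<open>k\<close> force the index chosen below to
    be at least \<open>k\<close>.\<close>
  fix t assume t: "t \<ge> Max (insert 1 ((\<lambda>m. real_of_int (height (P m))) ` {..k}))"
  then have t_ge: "t \<ge> 1" "\<And>m. m \<le> k \<Longrightarrow> height (P m) \<le> t"
    by auto
  \<comment> \<open>Heights are not assumed monotone; minimality is what gives
    \<open>height (P m) \<le> t\<close>.\<close>
  define m where "m = (LEAST m. height (P (Suc m)) > t)"
  have "height (P (Suc (nat \<lceil>t\<rceil>))) > t"
    using P(3)[of "Suc (nat \<lceil>t\<rceil>)"] t_ge(1) by linarith
  then have m: "height (P (Suc m)) > t"
    unfolding m_def by (rule LeastI)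
  have "m \<ge> k"
    using m t_ge(2)[of "Suc m"] by (meson not_less not_less_eq_eq)
  have "height (P m) \<le> t"
  proof (cases m)
    case 0
    then show ?thesis using t_ge(2)[of 0] by simp
  next
    case (Suc m')
    then show ?thesis
      using not_less_Least[of m' "\<lambda>m. height (P (Suc m)) > t"] by (simp add: m_def[symmetric] not_less)
  qed
  moreover have "f (height (P (Suc m))) \<le> f t"
    using noninc t_ge(1) m by (auto simp: monotone_on_def)
  moreover have "total_degree (P m) \<le> k"
    using P(2)[of m] k by simp
  ultimately show "\<exists>P :: 'n int_mpoly. P \<noteq> 0 \<and> total_degree P \<le> k \<and> height P \<le> t \<and> \<bar>eval_mpoly P x\<bar> \<le> f t"
    using P(1)[of m] small[OF \<open>m \<ge> k\<close>] by (intro exI[of _ "P m"]) auto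
qed

text \<open>A Baire-type argument: stage \<open>m\<close> avoids the zeros of the
  \<open>m\<close>-th function of \<open>G\<close> and secures the estimates for the finitely many
  degrees from \<open>1\<close> to \<open>m\<close>. Each degree is thus handled at all but finitely
  many stages.\<close>

lemma uniform_vector_avoiding:
  fixes Y :: "(real ^ 'n::finite) set" and f :: "nat \<Rightarrow> real \<Rightarrow> real"
  assumes pos: "\<And>k t. k \<ge> 1 \<Longrightarrow> t > 0 \<Longrightarrow> f k t > 0"
    and noninc: "\<And>k. k \<ge> 1 \<Longrightarrow> antimono_on {0<..} (f k)"
    and "closed Y" and family: "hyperplane_family Y \<C>"
    and U: "C0 \<in> \<C>" "open U" "U \<inter> C0 \<noteq> {}"
    and G: "countable G" "\<And>g. g \<in> G \<Longrightarrow> real_polynomial_function g" "\<And>g. g \<in> G \<Longrightarrow> \<exists>x. g x \<noteq> 0"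
  shows "\<exists>x\<in>U \<inter> Y. (\<forall>k\<ge>1. uniform_of_degree (f k) k x) \<and> (\<forall>g\<in>G. g x \<noteq> 0)"
proof -
  have subY: "C \<subseteq> Y" if "C \<in> \<C>" for C
    using family that by (auto simp: hyperplane_family_def)
  note poly = mpoly_vanishing_on_family_member[OF family]
  \<comment> \<open>The constant \<open>1\<close> makes the enumerated set nonempty and imposes no
    condition.\<close>
  define gs where "gs = from_nat_into (insert (\<lambda>_. 1) G)"
  have gs_range: "range gs = insert (\<lambda>_. 1) G"
    unfolding gs_def using G(1) by (intro range_from_nat_into) auto
  have gs: "real_polynomial_function (gs m)" "\<exists>x. gs m x \<noteq> 0" for m
  proof -
    have "gs m \<in> insert (\<lambda>_. 1) G"
      using gs_range by blast
    then show "real_polynomial_function (gs m)" "\<exists>x. gs m x \<noteq> 0"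
      using G(2,3) by (auto intro: real_polynomial_function.intros(2))
  qed
  define inv where "inv m s \<longleftrightarrow> (case s of (P :: 'n int_mpoly, C, V) \<Rightarrow>
      P \<noteq> 0 \<and> total_degree P \<le> 1 \<and> height P \<ge> int m \<and> (\<forall>x\<in>C. eval_mpoly P x = 0) \<and>
      C \<in> \<C> \<and> open V \<and> V \<inter> C \<noteq> {})" for m :: nat and s
  \<comment> \<open>The old polynomial \<open>P\<close> is bounded on the new set \<open>V'\<close>
    in terms of the height of the new polynomial \<open>P'\<close>, so \<open>P'\<close> must be
    fixed before \<open>V'\<close>.\<close>
  define step where "step m s s' \<longleftrightarrow> (case s of (P :: 'n int_mpoly, C, V) \<Rightarrow> case s' of (P' :: 'n int_mpoly, C', V') \<Rightarrow>
      compact (closure V') \<and> closure V' \<subseteq> V \<and>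
      (\<forall>x\<in>V'. (\<forall>k\<in>{1..m}. \<bar>eval_mpoly P x\<bar> \<le> f k (height P')) \<and> gs m x \<noteq> 0))"
    for m :: nat and s s' :: "'n int_mpoly \<times> (real ^ 'n) set \<times> (real ^ 'n) set"
  have "\<exists>S. \<forall>m. (inv m (S m) \<and> (m = 0 \<longrightarrow> snd (snd (S m)) = U)) \<and> step m (S m) (S (Suc m))"
  proof (intro dependent_nat_choice)
    obtain P :: "'n int_mpoly" where "P \<noteq> 0 \<and> total_degree P \<le> 1 \<and> height P \<ge> int 0 \<and> (\<forall>x\<in>C0. eval_mpoly P x = 0)"
      using poly[OF U(1)] by blast
    then show "\<exists>s. inv 0 s \<and> (0 = 0 \<longrightarrow> snd (snd s) = U)"
      using U by (intro exI[of _ "(P, C0, U)"]) (simp add: inv_def)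
  next
    fix s m
    assume "inv m s \<and> (m = 0 \<longrightarrow> snd (snd s) = U)"
    moreover obtain P C V where s: "s = (P, C, V)"
      using prod_cases3 by blast
    ultimately have P: "\<And>x. x \<in> C \<Longrightarrow> eval_mpoly P x = 0"
      and C: "C \<in> \<C>" and V: "open V" "V \<inter> C \<noteq> {}"
      by (auto simp: inv_def)
    obtain C' where C': "C' \<in> \<C>" "V \<inter> C \<inter> C' \<noteq> {}" "zeros_nowhere_dense_in (gs m) C'"
      using family[unfolded hyperplane_family_def, THEN conjunct2, rule_format, of C V "gs m"] C V gs[of m]
      by auto
    obtain P' :: "'n int_mpoly" where P': "P' \<noteq> 0" "total_degree P' \<le> 1" "height P' \<ge> int (Suc m)"
        "\<And>x. x \<in> C' \<Longrightarrow> eval_mpoly P' x = 0"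
      using poly[OF C'(1), of "Suc m"] by blast
    \<comment> \<open>The entry \<open>1\<close> covers \<open>m = 0\<close>, where there is no
      degree to treat. The height of \<open>P'\<close> is positive, so every \<open>f k\<close> is
      positive there.\<close>
    define \<delta> where "\<delta> = Min (insert 1 ((\<lambda>k. f k (height P')) ` {1..m}))"
    have "\<delta> > 0"
      using P'(3) unfolding \<delta>_def by (subst Min_gr_iff) (auto intro!: pos)
    have \<delta>_le: "\<delta> \<le> f k (height P')" if "k \<in> {1..m}" for k
      using that unfolding \<delta>_def by (intro Min_le) auto
    obtain W where W: "open W" "W \<inter> C' \<noteq> {}" "compact (closure W)" "closure W \<subseteq> V"
      "\<And>x. x \<in> W \<Longrightarrow> \<bar>eval_mpoly P x\<bar> < \<delta>" "\<And>x. x \<in> W \<Longrightarrow> gs m x \<noteq> 0"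
      using shrink_avoiding[OF V(1) C'(2) P gs(1)[of m] C'(3) \<open>\<delta> > 0\<close>] by blast
    have "inv (Suc m) (P', C', W)"
      using P' C'(1) W(1,2) by (simp add: inv_def)
    moreover have "\<bar>eval_mpoly P x\<bar> \<le> f k (height P')" if "x \<in> W" "k \<in> {1..m}" for x k
      using W(5)[OF that(1)] \<delta>_le[OF that(2)] by linarith
    then have "step m s (P', C', W)"
      using W(3,4,6) by (simp add: step_def s)
    ultimately show "\<exists>s'. (inv (Suc m) s' \<and> (Suc m = 0 \<longrightarrow> snd (snd s') = U)) \<and> step m s s'"
      by blast
  qed
  then obtain S where S: "\<And>m. inv m (S m)" "snd (snd (S 0)) = U" "\<And>m. step m (S m) (S (Suc m))"
    by blast
  define P where "P m = fst (S m)" for m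
  define C where "C m = fst (snd (S m))" for m
  define V where "V m = snd (snd (S m))" for m
  have S_eq: "S m = (P m, C m, V m)" for m
    by (simp add: P_def C_def V_def)
  have P: "P m \<noteq> 0" "total_degree (P m) \<le> 1" "height (P m) \<ge> int m"
    and C: "C m \<in> \<C>" and V: "V m \<inter> C m \<noteq> {}" for m
    using S(1)[of m] by (auto simp: inv_def S_eq)
  have nest: "compact (closure (V (Suc m)))" "closure (V (Suc m)) \<subseteq> V m"
    and small: "x \<in> V (Suc m) \<Longrightarrow> k \<in> {1..m} \<Longrightarrow> \<bar>eval_mpoly (P m) x\<bar> \<le> f k (height (P (Suc m)))"
    and nonzero: "x \<in> V (Suc m) \<Longrightarrow> gs m x \<noteq> 0" for m x k
    using S(3)[of m] by (auto simp: step_def S_eq)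
  \<comment> \<open>The index starts at \<open>Suc m\<close> because \<open>V 0 = U\<close> may be
    unbounded. Each \<open>F m\<close> contains a point of \<open>C (Suc m)\<close>, and
    intersecting with the closed set \<open>Y\<close> keeps the limit in \<open>Y\<close>.\<close>
  define F where "F m = closure (V (Suc m)) \<inter> Y" for m
  have "\<Inter>(range F) \<noteq> {}"
  proof (rule compact_nest)
    show "compact (F m)" for m
      unfolding F_def using nest(1) \<open>closed Y\<close> by (intro compact_Int_closed)
    show "F m \<noteq> {}" for m
      using V[of "Suc m"] subY[OF C[of "Suc m"]] closure_subset by (fastforce simp: F_def)
    show "F n \<subseteq> F m" if "m \<le> n" for m n
      using that
    proof (rule lift_Suc_antimono_le[rotated])
      show "F (Suc m) \<subseteq> F m" for m
        using nest(2)[of "Suc m"] closure_subset by (fastforce simp: F_def)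
    qed
  qed
  then obtain x where "\<And>m. x \<in> F m"
    by auto
  then have x: "x \<in> V m" "x \<in> Y" for m
    using nest(2)[of m] by (auto simp: F_def)
  have "uniform_of_degree (f k) k x" if k: "k \<ge> 1" for k
    using P small[OF x(1)] k by (intro uniform_of_degreeI[of P]) (auto intro: noninc)
  moreover have "g x \<noteq> 0" if "g \<in> G" for g
  proof -
    have "g \<in> range gs"
      unfolding gs_range using that by (rule insertI2)
    then obtain m where "g = gs m"
      by (rule rangeE)
    then show ?thesis
      using nonzero[OF x(1)[of "Suc m"]] by simp
  qed
  moreover have "x \<in> U"
    using x(1)[of 0] S(2) by (simp add: V_def)
  ultimately show ?thesis
    using x(2) by blast
qed

lemma dense_uncountable_uniform:
  fixes Y :: "(real ^ 'n::finite) set" and f :: "nat \<Rightarrow> real \<Rightarrow> real"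
  assumes f: "\<And>k t. k \<ge> 1 \<Longrightarrow> t > 0 \<Longrightarrow> f k t > 0" "\<And>k. k \<ge> 1 \<Longrightarrow> antimono_on {0<..} (f k)"
    and Y: "closed Y" "Y \<noteq> {}" and family: "hyperplane_family Y \<C>" and dense: "Y \<subseteq> closure (\<Union>\<C>)"
  shows "has_dense_uncountable_subset Y
    (\<lambda>x. \<not> algebraic_vector x \<and> (\<forall>k\<ge>1. uniform_of_degree (f k) k x))"
proof -
  define D where "D = {x \<in> Y. \<not> algebraic_vector x \<and> (\<forall>k\<ge>1. uniform_of_degree (f k) k x)}"
  define G :: "(real ^ 'n \<Rightarrow> real) set" where "G = eval_mpoly ` (UNIV - {0})"
  have G: "countable G"
    unfolding G_def using countable_int_mpoly countable_subset by blast
  have G_poly: "real_polynomial_function g" "\<exists>x. g x \<noteq> 0" if "g \<in> G" for g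
    using that real_polynomial_function_eval_mpoly eval_mpoly_not_identically_zero
    unfolding G_def by blast+
  \<comment> \<open>The squared distance to \<open>d\<close>: avoiding its zero set means avoiding
    the point \<open>d\<close>.\<close>
  define q :: "real ^ 'n \<Rightarrow> real ^ 'n \<Rightarrow> real" where "q d x = (\<Sum>i\<in>UNIV. (x $ i - d $ i) * (x $ i - d $ i))" for d x
  have q: "real_polynomial_function (q d)" for d
    unfolding q_def[abs_def]
    by (intro real_polynomial_function_sum real_polynomial_function.intros(2,4)
        real_polynomial_function_diff real_polynomial_function_component) simp
  have q_nz: "\<exists>x. q d x \<noteq> 0" for d
  proof
    show "q d (d + 1) \<noteq> 0" by (simp add: q_def)
  qed
  \<comment> \<open>With \<open>E\<close> empty this yields density; with \<open>E = D\<close> it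
    refutes countability of \<open>D\<close>.\<close>
  have exists: "\<exists>x\<in>U \<inter> D. x \<notin> E" if U: "open U" "U \<inter> Y \<noteq> {}" and E: "countable E" for U E
  proof -
    have "U \<inter> \<Union>\<C> \<noteq> {}"
      using U dense open_Int_closure_eq_empty[OF U(1)] by blast
    then obtain C where C: "C \<in> \<C>" "U \<inter> C \<noteq> {}" by blast
    have "\<exists>x\<in>U \<inter> Y. (\<forall>k\<ge>1. uniform_of_degree (f k) k x) \<and> (\<forall>g\<in>G \<union> q ` E. g x \<noteq> 0)"
    proof (rule uniform_vector_avoiding[OF f Y(1) family C(1) U(1) C(2)])
      show "countable (G \<union> q ` E)"
        using G E by simp
      show "real_polynomial_function g" "\<exists>x. g x \<noteq> 0" if "g \<in> G \<union> q ` E" for g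
        using that G_poly[of g] q q_nz by blast+
    qed
    then obtain x where x: "x \<in> U \<inter> Y" "\<forall>k\<ge>1. uniform_of_degree (f k) k x" "\<forall>g\<in>G \<union> q ` E. g x \<noteq> 0"
      by blast
    have "\<not> algebraic_vector x"
      using x(3) by (auto simp: algebraic_vector_def G_def)
    moreover have "x \<notin> E"
    proof
      assume "x \<in> E"
      then have "q x x \<noteq> 0" using x(3) by blast
      then show False by (simp add: q_def)
    qed
    ultimately show ?thesis
      using x by (auto simp: D_def)
  qed
  have "Y \<subseteq> closure D"
  proof (rule ccontr)
    assume "\<not> Y \<subseteq> closure D"
    then obtain x where "x \<in> - closure D \<inter> D"
      using exists[of "- closure D" "{}"] by auto
    then show False
      using closure_subset by blast
  qed
  moreover have "uncountable D"
    using exists[of UNIV D] Y(2) by auto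
  ultimately show ?thesis
    unfolding has_dense_uncountable_subset_def
    by (intro exI[of _ D]) (auto simp: D_def)
qed

text \<open>One extra power of \<open>t\<close> in the decay eventually beats every constant
  \<epsilon>, so uniformity for a single function per degree already implies singularity.\<close>

lemma dense_uncountable_singular:
  fixes Y :: "(real ^ 'n::finite) set"
  assumes "closed Y" "Y \<noteq> {}" "hyperplane_family Y \<C>" "Y \<subseteq> closure (\<Union>\<C>)"
  shows "has_dense_uncountable_subset Y
    (\<lambda>x. \<not> algebraic_vector x \<and> (\<forall>k\<ge>1. singular_of_degree k x))"
proof -
  define N where "N k = real (((k + CARD('n)) choose CARD('n)) - 1)" for k
  define f where "f k t = t powr - (N k + 1)" for k t
  have singular: "singular_of_degree k x" if u: "uniform_of_degree (f k) k x" for k and x :: "real ^ 'n"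
    unfolding singular_of_degree_def
  proof (intro allI impI)
    fix \<epsilon> :: real assume "\<epsilon> > 0"
    have "\<forall>\<^sub>F t in at_top. f k t \<le> \<epsilon> * t powr - N k"
    proof (rule eventually_at_top_linorderI)
      fix t assume t: "t \<ge> max 1 (1 / \<epsilon>)"
      then have "1 \<le> \<epsilon> * t" "t > 0"
        using \<open>\<epsilon> > 0\<close> by (auto simp: field_simps)
      then have "1 / t \<le> \<epsilon>"
        by (simp add: field_simps)
      moreover have "f k t = t powr - N k * (1 / t)"
        using \<open>t > 0\<close> by (simp add: f_def powr_diff)
      moreover have "t powr - N k * (1 / t) \<le> t powr - N k * \<epsilon>"
        using \<open>1 / t \<le> \<epsilon>\<close> by (intro mult_left_mono) auto
      ultimately show "f k t \<le> \<epsilon> * t powr - N k"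
        by (simp only: mult.commute)
    qed
    with u show "uniform_of_degree (\<lambda>t. \<epsilon> * t powr - real (((k + CARD('n)) choose CARD('n)) - 1)) k x"
      unfolding uniform_of_degree_def N_def by eventually_elim (meson order.trans)
  qed
  have "has_dense_uncountable_subset Y
      (\<lambda>x. \<not> algebraic_vector x \<and> (\<forall>k\<ge>1. uniform_of_degree (f k) k x))"
  proof (rule dense_uncountable_uniform[OF _ _ assms])
    show "f k t > 0" if "t > 0" for k t
      using that by (simp add: f_def)
    show "antimono_on {0<..} (f k)" for k
      unfolding f_def monotone_on_def by (auto intro!: powr_mono2' simp: N_def)
  qed
  then show ?thesis
    unfolding has_dense_uncountable_subset_def using singular by blast
qed

section \<open>Products of perfect sets\<close>

lemma rational_hyperplane_component:
  "b \<in> \<rat> \<Longrightarrow> rational_hyperplane {x :: real ^ 'n::finite. x $ l = b}"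
  unfolding rational_hyperplane_def
  by (intro exI[of _ "axis l 1"] exI[of _ b] conjI allI)
    (simp add: axis_def, simp_all add: inner_axis' axis_eq_0_iff)

definition coordinate_slices :: "'n \<Rightarrow> 'n \<Rightarrow> (real ^ 'n::finite) set \<Rightarrow> (real ^ 'n) set set" where
  "coordinate_slices i j Y = {Y \<inter> {x. x $ l = b} | l b. l \<in> {i, j} \<and> b \<in> \<rat>}"

lemma infinite_open_Int_perfect_set:
  fixes S :: "'a::t1_space set"
  shows "perfect_set S \<Longrightarrow> open A \<Longrightarrow> x \<in> A \<Longrightarrow> x \<in> S \<Longrightarrow> infinite (A \<inter> S)"
  by (auto simp: perfect_set_def islimpt_eq_acc_point)

text \<open>Limit points of the closure of \<open>D\<close> are limit points of \<open>D\<close>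
  itself, so accumulation in \<open>S\<close> passes to \<open>D\<close>.\<close>

lemma infinite_open_Int_dense_subset:
  fixes S :: "'a::metric_space set"
  assumes "perfect_set S" "S \<subseteq> closure D" "open A" "x \<in> A" "x \<in> S"
  shows "infinite (A \<inter> D)"
proof -
  have "x islimpt closure D"
    using assms by (auto simp: perfect_set_def intro: islimpt_subset)
  then have "x islimpt D"
    by (simp only: limpt_of_closure)
  then show ?thesis
    using assms(3,4) unfolding islimpt_eq_acc_point by blast
qed

text \<open>If the zeros of \<open>g\<close> fill a relatively open piece of the slice, they contain
  a box whose sides in all directions except \<open>l\<close> are infinite, by perfectness. Such a
  box determines \<open>g\<close> on the whole hyperplane.\<close>

lemma zero_on_hyperplane_if_locally_zero_on_slice:
  fixes Y :: "(real ^ 'n::finite) set"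
  assumes perfect: "\<And>l. perfect_set (Ys l)" and Y: "Y = {x. \<forall>l. x $ l \<in> Ys l}"
    and g: "real_polynomial_function g"
    and not_dense: "\<not> zeros_nowhere_dense_in g (Y \<inter> {x. x $ l = b})" and y: "y $ l = b"
  shows "g y = 0"
proof -
  obtain V v where V: "open V" "v \<in> V" "v \<in> Y" "v $ l = b"
    and zero: "\<And>x. x \<in> V \<Longrightarrow> x \<in> Y \<Longrightarrow> x $ l = b \<Longrightarrow> g x = 0"
    using not_dense by (auto simp: zeros_nowhere_dense_in_def)
  obtain A where A: "\<And>m. open (A m)" "\<And>m. v $ m \<in> A m" "\<And>x. (\<And>m. x $ m \<in> A m) \<Longrightarrow> x \<in> V"
    using V(1)[unfolded open_vec_def, rule_format, OF V(2)] by blast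
  show ?thesis
  proof (rule real_polynomial_function_zero_on_box[OF g, of "- {l}" "\<lambda>m. A m \<inter> Ys m" v])
    show "infinite (A m \<inter> Ys m)" for m
      using A(1,2) V(3) by (intro infinite_open_Int_perfect_set[OF perfect, of _ "v $ m"]) (auto simp: Y)
    fix x assume x: "\<And>m. m \<in> - {l} \<Longrightarrow> x $ m \<in> A m \<inter> Ys m" "\<And>m. m \<notin> - {l} \<Longrightarrow> x $ m = v $ m"
    then have "x $ m \<in> A m \<inter> Ys m" for m
      using A(2)[of m] V(3) by (cases "m = l") (auto simp: Y)
    then show "g x = 0"
      using x(2)[of l] V(4) A(3) by (intro zero) (auto simp: Y)
  qed (use y V(4) in auto)
qed

text \<open>A slice in one of the directions \<open>i\<close>, \<open>j\<close> is crossed by slices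
  in the other, at infinitely many rational heights near a given point. Were each of these bad for
  \<open>g\<close>, then \<open>g\<close> would vanish on infinitely many parallel hyperplanes and
  hence everywhere.\<close>

lemma hyperplane_family_coordinate_slices:
  fixes Y :: "(real ^ 'n::finite) set"
  assumes perfect: "\<And>l. perfect_set (Ys l)" and Y: "Y = {x. \<forall>l. x $ l \<in> Ys l}"
    and rational: "\<And>l. l \<in> {i, j} \<Longrightarrow> Ys l \<subseteq> closure (\<rat> \<inter> Ys l)" and ij: "i \<noteq> j"
  shows "hyperplane_family Y (coordinate_slices i j Y)"
  unfolding hyperplane_family_def
proof (intro conjI ballI allI impI)
  fix C assume "C \<in> coordinate_slices i j Y"
  then obtain l b where l: "l \<in> {i, j}" "b \<in> \<rat>" and C: "C = Y \<inter> {x. x $ l = b}"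
    by (auto simp: coordinate_slices_def)
  show "C \<subseteq> Y" by (simp add: C)
  show "\<exists>L. rational_hyperplane L \<and> C \<subseteq> L"
    using rational_hyperplane_component[OF l(2), of l] C by blast
  fix U g
  assume "open U \<and> U \<inter> C \<noteq> {} \<and> real_polynomial_function g \<and> (\<exists>x :: real ^ 'n. g x \<noteq> 0)"
  then have "open U" and "U \<inter> C \<noteq> {}" and g: "real_polynomial_function g"
    and g_nz: "\<exists>x :: real ^ 'n. g x \<noteq> 0"
    by auto
  then obtain z where z: "z \<in> U" "z \<in> Y" "z $ l = b" by (auto simp: C)
  obtain A where A: "\<And>m. open (A m)" "\<And>m. z $ m \<in> A m" "\<And>x. (\<And>m. x $ m \<in> A m) \<Longrightarrow> x \<in> U"
    using \<open>open U\<close>[unfolded open_vec_def, rule_format, OF z(1)] by blast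
  obtain l' where l': "l' \<in> {i, j}" "l' \<noteq> l" using ij l(1) by blast
  define B where "B = A l' \<inter> (\<rat> \<inter> Ys l')"
  have B: "infinite B"
    unfolding B_def using A(1,2) z(2)
    by (intro infinite_open_Int_dense_subset[OF perfect rational[OF l'(1)], of _ "z $ l'"]) (auto simp: Y)
  have "\<exists>b'\<in>B. zeros_nowhere_dense_in g (Y \<inter> {x. x $ l' = b'})"
  proof (rule ccontr)
    assume *: "\<not> ?thesis"
    have "g x = 0" for x
    proof -
      have "g (x + t *\<^sub>R axis l' 1) = 0" if "t \<in> (\<lambda>s. s - x $ l') ` B" for t
        using that * by (auto intro!: zero_on_hyperplane_if_locally_zero_on_slice[OF perfect Y g])
      moreover have "infinite ((\<lambda>s. s - x $ l') ` B)"
        using B by (subst finite_image_iff) (auto simp: inj_on_def)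
      ultimately show ?thesis
        using real_polynomial_function_zero_on_line[OF g, of _ x "axis l' 1" 0] by simp
    qed
    with g_nz show False by blast
  qed
  then obtain b' where b': "b' \<in> B" "zeros_nowhere_dense_in g (Y \<inter> {x. x $ l' = b'})" by blast
  \<comment> \<open>Only coordinate \<open>l'\<close> moves, so the point stays on the old slice;
    \<open>A l'\<close> keeps it in \<open>U\<close>.\<close>
  define w where "w = (\<chi> m. if m = l' then b' else z $ m)"
  have "w \<in> U"
    using A(2) b'(1) by (intro A(3)) (auto simp: w_def B_def)
  moreover have "w \<in> Y" "w $ l = b" "w $ l' = b'"
    using z b'(1) l'(2) by (auto simp: w_def B_def Y)
  ultimately have "U \<inter> C \<inter> (Y \<inter> {x. x $ l' = b'}) \<noteq> {}"
    by (auto simp: C)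
  moreover have "Y \<inter> {x. x $ l' = b'} \<in> coordinate_slices i j Y"
    using l'(1) b'(1) by (auto simp: coordinate_slices_def B_def)
  ultimately show "\<exists>C'\<in>coordinate_slices i j Y. U \<inter> C \<inter> C' \<noteq> {} \<and> zeros_nowhere_dense_in g C'"
    using b'(2) by (intro bexI[of _ "Y \<inter> {x. x $ l' = b'}"] conjI)
qed

text \<open>Moving only coordinate \<open>i\<close> of a point of \<open>Y\<close> to a nearby
  rational of \<open>Ys i\<close> already reaches a slice.\<close>

lemma closure_coordinate_slices:
  fixes Y :: "(real ^ 'n::finite) set"
  assumes perfect: "\<And>l. perfect_set (Ys l)" and Y: "Y = {x. \<forall>l. x $ l \<in> Ys l}"
    and rational: "\<And>l. l \<in> {i, j} \<Longrightarrow> Ys l \<subseteq> closure (\<rat> \<inter> Ys l)"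
  shows "Y \<subseteq> closure (\<Union>(coordinate_slices i j Y))"
proof (rule ccontr)
  let ?U = "- closure (\<Union>(coordinate_slices i j Y))"
  assume "\<not> ?thesis"
  then obtain z where z: "z \<in> Y" "z \<in> ?U" by auto
  have "open ?U" by (simp add: open_Compl)
  obtain A where A: "\<And>m. open (A m)" "\<And>m. z $ m \<in> A m" "\<And>x. (\<And>m. x $ m \<in> A m) \<Longrightarrow> x \<in> ?U"
    using \<open>open ?U\<close>[unfolded open_vec_def, rule_format, OF z(2)] by blast
  have "infinite (A i \<inter> (\<rat> \<inter> Ys i))"
    using A(1,2) z(1) by (intro infinite_open_Int_dense_subset[OF perfect rational, of i _ "z $ i"]) (auto simp: Y)
  then have "A i \<inter> (\<rat> \<inter> Ys i) \<noteq> {}"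
    by (metis finite.emptyI)
  then obtain b where b: "b \<in> A i" "b \<in> \<rat>" "b \<in> Ys i"
    by blast
  define w where "w = (\<chi> m. if m = i then b else z $ m)"
  have "w \<in> ?U"
    using A(2) b(1) by (intro A(3)) (auto simp: w_def)
  moreover have "w \<in> Y \<inter> {x. x $ i = b}"
    using z b by (auto simp: w_def Y)
  then have "w \<in> \<Union>(coordinate_slices i j Y)"
    using b(2) by (auto simp: coordinate_slices_def)
  then have "w \<in> closure (\<Union>(coordinate_slices i j Y))"
    by (rule subsetD[OF closure_subset])
  ultimately show False
    by simp
qed

lemma closed_product_perfect_sets:
  fixes Ys :: "'n::finite \<Rightarrow> real set"
  assumes perfect: "\<And>l. perfect_set (Ys l)"
  shows "closed {x :: real ^ 'n. \<forall>l. x $ l \<in> Ys l}"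
proof -
  have "closed {x :: real ^ 'n. x $ l \<in> Ys l}" for l
    using perfect[of l] closed_vimage[of "Ys l" "\<lambda>x. x $ l"]
    by (simp add: perfect_set_def vimage_def continuous_on_component continuous_on_id)
  then show ?thesis
    by (rule closed_Collect_all)
qed

section \<open>Koch snowflakes\<close>

text \<open>With the plane read as the complex numbers this is \<open>c + d * p\<close>;
  \<open>oriented_similarity 0 d p\<close> is the complex product.\<close>

definition oriented_similarity :: "real ^ 2 \<Rightarrow> real ^ 2 \<Rightarrow> real ^ 2 \<Rightarrow> real ^ 2" where
  "oriented_similarity c d p = c + (p $ 1) *\<^sub>R d + (p $ 2) *\<^sub>R vector [- (d $ 2), d $ 1]"

lemma oriented_similarity_components:
  "oriented_similarity c d p $ 1 = c $ 1 + p $ 1 * d $ 1 - p $ 2 * d $ 2"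
  "oriented_similarity c d p $ 2 = c $ 2 + p $ 1 * d $ 2 + p $ 2 * d $ 1"
  by (simp_all add: oriented_similarity_def)

lemma vec2_eq_iff: "x = y \<longleftrightarrow> x $ 1 = y $ 1 \<and> x $ 2 = y $ 2"
  for x y :: "'a ^ 2"
  by (simp add: vec_eq_iff forall_2)

lemma oriented_similarity_on_axis: "oriented_similarity c d (vector [t, 0]) = c + t *\<^sub>R d"
  by (simp add: oriented_similarity_def)

lemma oriented_similarity_comp:
  "oriented_similarity c d \<circ> oriented_similarity c' d' =
   oriented_similarity (oriented_similarity c d c') (oriented_similarity 0 d d')"
  by (rule ext) (simp add: vec2_eq_iff oriented_similarity_components algebra_simps)

lemma oriented_similarity_0_eq_0_iff: "oriented_similarity 0 d p = 0 \<longleftrightarrow> d = 0 \<or> p = 0"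
proof -
  \<comment> \<open>Multiplicativity of the squared complex modulus.\<close>
  have "(p $ 1 * d $ 1 - p $ 2 * d $ 2)\<^sup>2 + (p $ 1 * d $ 2 + p $ 2 * d $ 1)\<^sup>2 =
      ((p $ 1)\<^sup>2 + (p $ 2)\<^sup>2) * ((d $ 1)\<^sup>2 + (d $ 2)\<^sup>2)"
    by (simp add: power2_eq_square algebra_simps)
  then show ?thesis
    unfolding vec2_eq_iff oriented_similarity_components
    by (simp add: sum_power2_eq_zero_iff[symmetric] del: sum_power2_eq_zero_iff) auto
qed

lemma surj_oriented_similarity:
  assumes "d \<noteq> 0"
  shows "\<exists>p. oriented_similarity c d p = q"
proof -
  let ?n = "(d $ 1)\<^sup>2 + (d $ 2)\<^sup>2"
  \<comment> \<open>\<open>x\<close> and \<open>y\<close> are the real and imaginary parts of the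
    complex quotient of \<open>q - c\<close> by \<open>d\<close>.\<close>
  define x where "x = ((q $ 1 - c $ 1) * d $ 1 + (q $ 2 - c $ 2) * d $ 2) / ?n"
  define y where "y = ((q $ 2 - c $ 2) * d $ 1 - (q $ 1 - c $ 1) * d $ 2) / ?n"
  have n: "?n \<noteq> 0"
    using assms by (simp add: vec2_eq_iff sum_power2_eq_zero_iff)
  have "x * d $ 1 - y * d $ 2 = (q $ 1 - c $ 1) * ?n / ?n"
    unfolding x_def y_def times_divide_eq_left diff_divide_distrib[symmetric]
    by (simp add: power2_eq_square algebra_simps)
  then have "x * d $ 1 - y * d $ 2 = q $ 1 - c $ 1"
    by (simp only: nonzero_mult_div_cancel_right[OF n])
  moreover have "x * d $ 2 + y * d $ 1 = (q $ 2 - c $ 2) * ?n / ?n"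
    unfolding x_def y_def times_divide_eq_left add_divide_distrib[symmetric]
    by (simp add: power2_eq_square algebra_simps)
  then have "x * d $ 2 + y * d $ 1 = q $ 2 - c $ 2"
    by (simp only: nonzero_mult_div_cancel_right[OF n])
  ultimately show ?thesis
    by (intro exI[of _ "vector [x, y]"]) (simp add: vec2_eq_iff oriented_similarity_components)
qed

lemma continuous_on_oriented_similarity_axis:
  "continuous_on UNIV (\<lambda>t. oriented_similarity c d (vector [t, 0]))"
  unfolding oriented_similarity_on_axis by (intro continuous_intros)

text \<open>The columns of the linear part are orthogonal of length \<open>r\<close>. Positivity of
  the determinant then selects, among the two possible shapes, the matrix of a complex
  multiplication.\<close>

lemma orientation_preserving_similarityD:
  assumes "contracting_similarity \<phi>" "orientation_preserving \<phi>"
    and "\<phi> (vector [0, 0]) = c" "\<phi> (vector [1, 0]) = c'"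
  shows "\<phi> = oriented_similarity c (c' - c)" "c' \<noteq> c"
proof -
  obtain r where r: "r > 0" "\<And>p q. dist (\<phi> p) (\<phi> q) = r * dist p q"
    using assms(1) by (auto simp: contracting_similarity_def)
  obtain A k where A: "\<And>p. \<phi> p = A *v p + k" "det A > 0"
    using assms(2) by (auto simp: orientation_preserving_def)
  define a b e f where "a = A $ 1 $ 1" "b = A $ 1 $ 2" "e = A $ 2 $ 1" "f = A $ 2 $ 2"
  note abef = this
  have \<phi>: "\<phi> p $ 1 = a * p $ 1 + b * p $ 2 + k $ 1" "\<phi> p $ 2 = e * p $ 1 + f * p $ 2 + k $ 2" for p
    by (simp_all add: A(1) abef matrix_vector_mult_def sum_2)
  have "(a * x + b * y)\<^sup>2 + (e * x + f * y)\<^sup>2 = r\<^sup>2 * (x\<^sup>2 + y\<^sup>2)" for x y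
  proof -
    have "(dist (\<phi> (vector [x, y])) (\<phi> 0))\<^sup>2 = r\<^sup>2 * (dist (vector [x, y] :: real ^ 2) 0)\<^sup>2"
      by (simp only: r(2) power_mult_distrib)
    moreover have dist: "(dist p q)\<^sup>2 = (p $ 1 - q $ 1)\<^sup>2 + (p $ 2 - q $ 2)\<^sup>2" for p q :: "real ^ 2"
      unfolding dist_norm power2_norm_eq_inner inner_vec_def by (simp add: sum_2 power2_eq_square)
    ultimately show ?thesis
      unfolding dist by (simp add: \<phi>)
  qed
  \<comment> \<open>The two unit vectors give the column lengths, and their sum gives
    orthogonality.\<close>
  from this[of 1 0] this[of 0 1] this[of 1 1]
  have eqs: "a\<^sup>2 + e\<^sup>2 = r\<^sup>2" "b\<^sup>2 + f\<^sup>2 = r\<^sup>2" "a * b + e * f = 0"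
    by (auto simp: power2_eq_square algebra_simps)
  have "(a * f - b * e)\<^sup>2 + (a * b + e * f)\<^sup>2 = (a\<^sup>2 + e\<^sup>2) * (b\<^sup>2 + f\<^sup>2)"
    by (simp add: power2_eq_square algebra_simps)
  then have "(a * f - b * e)\<^sup>2 = (r\<^sup>2)\<^sup>2"
    unfolding eqs by (simp add: power2_eq_square[of "r\<^sup>2"])
  moreover have "0 \<le> a * f - b * e"
    using A(2) by (simp add: det_2 abef)
  ultimately have det: "a * f - b * e = r\<^sup>2"
    using power2_eq_imp_eq zero_le_power2 by blast
  \<comment> \<open>The right-hand side is \<open>r\<^sup>2 + r\<^sup>2 - 2 * r\<^sup>2\<close>, so
    both squares vanish.\<close>
  have "(a - f)\<^sup>2 + (b + e)\<^sup>2 = (a\<^sup>2 + e\<^sup>2) + (b\<^sup>2 + f\<^sup>2) - 2 * (a * f - b * e)"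
    by (simp add: power2_eq_square algebra_simps)
  then have "(a - f)\<^sup>2 + (b + e)\<^sup>2 = 0"
    unfolding det eqs by simp
  then have f: "f = a" "b = - e"
    by (auto simp: sum_power2_eq_zero_iff)
  show "\<phi> = oriented_similarity c (c' - c)"
    unfolding assms(3,4)[symmetric]
    by (rule ext) (simp add: vec2_eq_iff oriented_similarity_components \<phi> f algebra_simps)
  have "vector [1, 0] \<noteq> (vector [0, 0] :: real ^ 2)"
    by (simp add: vec2_eq_iff)
  then have "dist c' c > 0"
    unfolding assms(3,4)[symmetric] r(2) using r(1) by simp
  then show "c' \<noteq> c" by simp
qed

section \<open>Orbits under an iterated function system\<close>

inductive_set ifs_monoid :: "'i set \<Rightarrow> ('i \<Rightarrow> 'a \<Rightarrow> 'a) \<Rightarrow> ('a \<Rightarrow> 'a) set"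
  for I :: "'i set" and \<phi> :: "'i \<Rightarrow> 'a \<Rightarrow> 'a" where
  id: "id \<in> ifs_monoid I \<phi>"
| gen: "i \<in> I \<Longrightarrow> \<phi> i \<in> ifs_monoid I \<phi>"
| comp: "\<psi> \<in> ifs_monoid I \<phi> \<Longrightarrow> \<psi>' \<in> ifs_monoid I \<phi> \<Longrightarrow> \<psi> \<circ> \<psi>' \<in> ifs_monoid I \<phi>"

lemma ifs_monoid_attractor:
  assumes "is_attractor I \<phi> Y" "\<psi> \<in> ifs_monoid I \<phi>" "y \<in> Y"
  shows "\<psi> y \<in> Y"
  using assms(2,3)
proof (induction arbitrary: y)
  case (gen i)
  then show ?case
    using assms(1) unfolding is_attractor_def by blast
qed auto

text \<open>Each point of \<open>Y\<close> is the image of another point of \<open>Y\<close> under a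
  word of length \<open>n\<close>. Replacing that point by \<open>p\<close>, which may lie outside
  \<open>Y\<close>, changes the image by at most \<open>R ^ n * M\<close>.\<close>

lemma ifs_monoid_orbit_dense:
  fixes \<phi> :: "'i \<Rightarrow> 'a::metric_space \<Rightarrow> 'a"
  assumes Y: "is_attractor I \<phi> Y" and I: "finite I"
    and \<phi>: "\<And>i. i \<in> I \<Longrightarrow> contracting_similarity (\<phi> i)"
  shows "Y \<subseteq> closure {\<psi> p | \<psi>. \<psi> \<in> ifs_monoid I \<phi>}"
proof
  fix y assume "y \<in> Y"
  have "\<forall>i\<in>I. \<exists>r. 0 < r \<and> r < 1 \<and> (\<forall>p q. dist (\<phi> i p) (\<phi> i q) = r * dist p q)"
    using \<phi> unfolding contracting_similarity_def by blast
  then obtain r where r: "\<And>i. i \<in> I \<Longrightarrow> 0 < r i" "\<And>i. i \<in> I \<Longrightarrow> r i < 1"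
    "\<And>i p q. i \<in> I \<Longrightarrow> dist (\<phi> i p) (\<phi> i q) = r i * dist p q"
    by metis
  define R where "R = Max (insert 0 (r ` I))"
  have R: "0 \<le> R" "R < 1" "\<And>i. i \<in> I \<Longrightarrow> r i \<le> R"
    unfolding R_def using I r(2) by auto
  have "bounded Y"
    using Y by (auto simp: is_attractor_def compact_imp_bounded)
  then obtain M where M: "\<And>y. y \<in> Y \<Longrightarrow> dist p y \<le> M"
    unfolding bounded_any_center[of _ p] by blast
  have approx: "\<exists>\<psi>\<in>ifs_monoid I \<phi>. dist (\<psi> p) y \<le> R ^ n * M" if "y \<in> Y" for n y
    using that
  proof (induction n arbitrary: y)
    case 0
    then show ?case
      using M by (intro bexI[OF _ ifs_monoid.id]) simp
  next
    case (Suc n)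
    then obtain i y' where i: "i \<in> I" "y' \<in> Y" "y = \<phi> i y'"
      using Y unfolding is_attractor_def by blast
    obtain \<psi> where \<psi>: "\<psi> \<in> ifs_monoid I \<phi>" "dist (\<psi> p) y' \<le> R ^ n * M"
      using Suc.IH[OF i(2)] by blast
    have "dist ((\<phi> i \<circ> \<psi>) p) y = r i * dist (\<psi> p) y'"
      by (simp add: i r(3))
    also have "\<dots> \<le> R * (R ^ n * M)"
      using R(1,3) r(1) i(1) \<psi>(2) by (intro mult_mono) auto
    finally have "dist ((\<phi> i \<circ> \<psi>) p) y \<le> R ^ Suc n * M"
      by (simp add: mult.assoc)
    moreover have "\<phi> i \<circ> \<psi> \<in> ifs_monoid I \<phi>"
      using i(1) \<psi>(1) by (intro ifs_monoid.comp ifs_monoid.gen)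
    ultimately show ?case by blast
  qed
  show "y \<in> closure {\<psi> p | \<psi>. \<psi> \<in> ifs_monoid I \<phi>}"
    unfolding closure_approachable
  proof (intro allI impI)
    fix e :: real assume "e > 0"
    have "(\<lambda>n. R ^ n * M) \<longlonglongrightarrow> 0"
      using R by (intro tendsto_mult_left_zero LIMSEQ_power_zero) simp
    then obtain n where n: "R ^ n * M < e"
      using \<open>e > 0\<close> order_tendstoD(2)[of _ 0 sequentially e] eventually_happens'[OF sequentially_bot] by blast
    obtain \<psi> where "\<psi> \<in> ifs_monoid I \<phi>" "dist (\<psi> p) y \<le> R ^ n * M"
      using approx[OF \<open>y \<in> Y\<close>] by blast
    then show "\<exists>x\<in>{\<psi> p | \<psi>. \<psi> \<in> ifs_monoid I \<phi>}. dist x y < e"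
      using n by force
  qed
qed

section \<open>Rational lines and orbits on the horizontal axis\<close>

definition rational_vector :: "real ^ 'n::finite \<Rightarrow> bool" where
  "rational_vector x \<longleftrightarrow> (\<forall>i. x $ i \<in> \<rat>)"

lemma rational_vector_oriented_similarity:
  "rational_vector c \<Longrightarrow> rational_vector d \<Longrightarrow> rational_vector p \<Longrightarrow>
    rational_vector (oriented_similarity c d p)"
  by (simp add: rational_vector_def forall_2 oriented_similarity_components)

lemma rational_hyperplane_image_axis:
  assumes "rational_vector c" "rational_vector d" "d \<noteq> 0"
  shows "\<exists>L. rational_hyperplane L \<and> (\<forall>t. oriented_similarity c d (vector [t, 0]) \<in> L)"
proof -
  \<comment> \<open>The direction \<open>d\<close> of the image line turned by a right angle, hence
    a rational normal vector.\<close>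
  define a :: "real ^ 2" where "a = vector [- (d $ 2), d $ 1]"
  have inner: "a \<bullet> x = d $ 1 * x $ 2 - d $ 2 * x $ 1" for x
    by (simp add: a_def inner_vec_def sum_2)
  have "rational_hyperplane {x. a \<bullet> x = a \<bullet> c}"
    unfolding rational_hyperplane_def
  proof (intro exI conjI)
    show "\<forall>i. a $ i \<in> \<rat>" "a \<bullet> c \<in> \<rat>"
      using assms(1,2) by (simp_all add: inner) (simp_all add: a_def rational_vector_def forall_2)
    show "a \<noteq> 0"
      using assms(3) by (auto simp: a_def vec2_eq_iff)
  qed (rule refl)
  moreover have "a \<bullet> oriented_similarity c d (vector [t, 0]) = a \<bullet> c" for t
    by (simp add: inner oriented_similarity_components algebra_simps)
  ultimately show ?thesis by blast
qed

text \<open>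
  The maps \<open>t \<mapsto> a t + b\<close> are the restrictions to the horizontal axis of the compositions of the
  first and the last generator; the orbit of \<open>\<alpha>\<close> consists of points where a rotated copy of the
  axis crosses the axis.
\<close>

inductive axis_map :: "real \<Rightarrow> real \<Rightarrow> real \<Rightarrow> real \<Rightarrow> bool" for \<alpha> \<delta> :: real where
  id: "axis_map \<alpha> \<delta> 1 0"
| first: "axis_map \<alpha> \<delta> a b \<Longrightarrow> axis_map \<alpha> \<delta> (a * \<alpha>) b"
| last: "axis_map \<alpha> \<delta> a b \<Longrightarrow> axis_map \<alpha> \<delta> (a * (1 - \<delta>)) (b + a * \<delta>)"

definition crossings :: "real \<Rightarrow> real \<Rightarrow> real set" where
  "crossings \<alpha> \<delta> = {a * \<alpha> + b | a b. axis_map \<alpha> \<delta> a b}"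

text \<open>The orbit of \<open>0\<close> is included because the image of the origin is the point
  where a rotated copy of the axis meets the old one.\<close>

definition axis_part :: "real \<Rightarrow> real \<Rightarrow> real set" where
  "axis_part \<alpha> \<delta> = crossings \<alpha> \<delta> \<union> {b. \<exists>a. axis_map \<alpha> \<delta> a b}"

text \<open>A point in the orbit of \<open>0\<close> is approached by inserting the first generator,
  which fixes \<open>0\<close>, ever more often. A crossing is the image of \<alpha>, which the
  first generator maps to from \<open>1\<close>, the fixed point of the last one; so the last
  generator is inserted repeatedly after \<open>axis_map.first\<close>.\<close>

lemma islimpt_crossings:
  assumes \<alpha>: "0 < \<alpha>" "\<alpha> < 1" and \<delta>: "0 < \<delta>" "\<delta> < 1" and s: "s \<in> axis_part \<alpha> \<delta>"
  shows "s islimpt crossings \<alpha> \<delta>"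
proof -
  have pos: "a > 0" if "axis_map \<alpha> \<delta> a b" for a b
    using that by induction (use \<alpha> \<delta> in auto)
  have first_power: "axis_map \<alpha> \<delta> (a * \<alpha> ^ n) b" if "axis_map \<alpha> \<delta> a b" for a b n
  proof (induction n)
    case (Suc n)
    then show ?case using axis_map.first[OF Suc] by (simp add: mult_ac)
  qed (simp add: that)
  have last_power: "axis_map \<alpha> \<delta> (a * (1 - \<delta>) ^ n) (b + a * (1 - (1 - \<delta>) ^ n))"
    if "axis_map \<alpha> \<delta> a b" for a b n
  proof (induction n)
    case (Suc n)
    then show ?case using axis_map.last[OF Suc] by (simp add: algebra_simps)
  qed (simp add: that)
  have limpt: "x islimpt crossings \<alpha> \<delta>"
    if "\<And>n. x + c * q ^ n \<in> crossings \<alpha> \<delta>" "c \<noteq> 0" "0 < q" "q < 1" for x c q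
    unfolding islimpt_sequential
  proof (intro exI conjI allI)
    show "x + c * q ^ n \<in> crossings \<alpha> \<delta> - {x}" for n
      using that by simp
    have "(\<lambda>n. x + c * q ^ n) \<longlonglongrightarrow> x + c * 0"
      using that by (intro tendsto_intros LIMSEQ_power_zero) simp
    then show "(\<lambda>n. x + c * q ^ n) \<longlonglongrightarrow> x" by simp
  qed
  consider a b where "axis_map \<alpha> \<delta> a b" "s = b" | a b where "axis_map \<alpha> \<delta> a b" "s = a * \<alpha> + b"
    using s by (auto simp: axis_part_def crossings_def)
  then show ?thesis
  proof cases
    case 1
    have "s + a * \<alpha> * \<alpha> ^ n \<in> crossings \<alpha> \<delta>" for n
      unfolding crossings_def using first_power[OF 1(1), of n] 1(2)
      by (force simp: mult_ac add_ac)
    then show ?thesis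
      using limpt[of s "a * \<alpha>" \<alpha>] pos[OF 1(1)] \<alpha> by simp
  next
    case 2
    have "s + a * \<alpha> * (\<alpha> - 1) * (1 - \<delta>) ^ n \<in> crossings \<alpha> \<delta>" for n
    proof -
      have "s + a * \<alpha> * (\<alpha> - 1) * (1 - \<delta>) ^ n
          = (a * \<alpha> * (1 - \<delta>) ^ n) * \<alpha> + (b + a * \<alpha> * (1 - (1 - \<delta>) ^ n))"
        by (simp add: 2(2) algebra_simps)
      then show ?thesis
        unfolding crossings_def using last_power[OF axis_map.first[OF 2(1)], of n] by blast
    qed
    then show ?thesis
      using limpt[of s "a * \<alpha> * (\<alpha> - 1)" "1 - \<delta>"] pos[OF 2(1)] \<alpha> \<delta> by simp
  qed
qed

lemma crossings_subset_axis_part: "crossings \<alpha> \<delta> \<subseteq> axis_part \<alpha> \<delta>"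
  by (simp add: axis_part_def)

section \<open>The slices of a fixed snowflake\<close>

context
  fixes \<alpha> \<beta> \<gamma> \<delta> :: real and \<phi> :: "nat \<Rightarrow> real ^ 2 \<Rightarrow> real ^ 2" and Y :: "(real ^ 2) set"
  assumes rat: "\<alpha> \<in> \<rat>" "\<beta> \<in> \<rat>" "\<gamma> \<in> \<rat>" "\<delta> \<in> \<rat>"
    and ord: "0 < \<alpha>" "\<alpha> < \<beta>" "\<beta> < \<delta>" "\<delta> < 1" "0 < \<gamma>"
    and contracting: "\<And>i. i < 4 \<Longrightarrow> contracting_similarity (\<phi> i)"
    and oriented: "\<And>i. i < 4 \<Longrightarrow> orientation_preserving (\<phi> i)"
    and vertex0: "\<And>i. i < 4 \<Longrightarrow> \<phi> i (vector [0, 0]) = koch_vertices \<alpha> \<beta> \<gamma> \<delta> ! i"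
    and vertex1: "\<And>i. i < 4 \<Longrightarrow> \<phi> i (vector [1, 0]) = koch_vertices \<alpha> \<beta> \<gamma> \<delta> ! Suc i"
    and attractor: "is_attractor {..<4} \<phi> Y"
begin

abbreviation koch_maps :: "(real ^ 2 \<Rightarrow> real ^ 2) set" where
  "koch_maps \<equiv> ifs_monoid {..<4} \<phi>"

text \<open>Explicit orbit points stand in for the full intersection of \<open>Y\<close> with a
  line: they accumulate at each of their points, which is all that the polynomial argument asks
  for.\<close>

definition koch_slices :: "(real ^ 2) set set" where
  "koch_slices = {(\<lambda>t. \<psi> (vector [t, 0])) ` axis_part \<alpha> \<delta> | \<psi>. \<psi> \<in> koch_maps}"

lemma koch_generator:
  assumes "i < 4"
  shows "\<phi> i = oriented_similarity (koch_vertices \<alpha> \<beta> \<gamma> \<delta> ! i)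
      (koch_vertices \<alpha> \<beta> \<gamma> \<delta> ! Suc i - koch_vertices \<alpha> \<beta> \<gamma> \<delta> ! i)"
    "koch_vertices \<alpha> \<beta> \<gamma> \<delta> ! Suc i - koch_vertices \<alpha> \<beta> \<gamma> \<delta> ! i \<noteq> 0"
  using orientation_preserving_similarityD[OF contracting oriented vertex0 vertex1] assms by auto

lemma rational_koch_vertices: "i < 5 \<Longrightarrow> rational_vector (koch_vertices \<alpha> \<beta> \<gamma> \<delta> ! i)"
proof -
  have "\<forall>v\<in>set (koch_vertices \<alpha> \<beta> \<gamma> \<delta>). rational_vector v"
    using rat by (simp add: koch_vertices_def rational_vector_def forall_2)
  then show "i < 5 \<Longrightarrow> ?thesis"
    by (simp add: koch_vertices_def del: list.set)
qed

lemma koch_maps_similarity: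
  "\<psi> \<in> koch_maps \<Longrightarrow>
    \<exists>c d. \<psi> = oriented_similarity c d \<and> rational_vector c \<and> rational_vector d \<and> d \<noteq> 0"
proof (induction rule: ifs_monoid.induct)
  case id
  show ?case
    by (intro exI[of _ 0] exI[of _ "vector [1, 0]"])
      (auto simp: fun_eq_iff vec2_eq_iff oriented_similarity_components rational_vector_def forall_2)
next
  case (gen i)
  then have "i < 4" by simp
  have "rational_vector (koch_vertices \<alpha> \<beta> \<gamma> \<delta> ! Suc i - koch_vertices \<alpha> \<beta> \<gamma> \<delta> ! i)"
    using \<open>i < 4\<close> rational_koch_vertices[of i] rational_koch_vertices[of "Suc i"]
    by (simp add: rational_vector_def)
  then show ?case
    using koch_generator[OF \<open>i < 4\<close>] rational_koch_vertices[of i] \<open>i < 4\<close> by fastforce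
next
  case (comp \<psi> \<psi>')
  then obtain c d c' d' where eq: "\<psi> = oriented_similarity c d" "\<psi>' = oriented_similarity c' d'"
    and cd: "rational_vector c" "rational_vector d" "d \<noteq> 0"
    and cd': "rational_vector c'" "rational_vector d'" "d' \<noteq> 0"
    by blast
  have "rational_vector (0 :: real ^ 2)"
    by (simp add: rational_vector_def)
  with cd cd' have "rational_vector (oriented_similarity c d c')"
    "rational_vector (oriented_similarity 0 d d')" "oriented_similarity 0 d d' \<noteq> 0"
    by (auto simp: oriented_similarity_0_eq_0_iff intro: rational_vector_oriented_similarity)
  then show ?case
    unfolding eq oriented_similarity_comp by blast
qed

lemma koch_generators:
  "\<phi> 0 = oriented_similarity 0 (vector [\<alpha>, 0])"
  "\<phi> (Suc 0) = oriented_similarity (vector [\<alpha>, 0]) (vector [\<beta> - \<alpha>, \<gamma>])"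
  "\<phi> 3 = oriented_similarity (vector [\<delta>, 0]) (vector [1 - \<delta>, 0])"
  using koch_generator(1)[of 0] koch_generator(1)[of "Suc 0"] koch_generator(1)[of 3]
  by (simp_all add: fun_eq_iff vec2_eq_iff oriented_similarity_components koch_vertices_def
      numeral_3_eq_3)

text \<open>The generators \<open>\<phi> 0\<close> and \<open>\<phi> 3\<close> preserve the
  horizontal axis; each rule of \<open>axis_map\<close> composes with one of them on the
  inside.\<close>

lemma axis_map_koch_maps:
  "axis_map \<alpha> \<delta> a b \<Longrightarrow> oriented_similarity (vector [b, 0]) (vector [a, 0]) \<in> koch_maps"
proof (induction rule: axis_map.induct)
  case id
  have "oriented_similarity (vector [0, 0]) (vector [1, 0]) = id"
    by (simp add: fun_eq_iff vec2_eq_iff oriented_similarity_components)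
  then show ?case
    by (metis ifs_monoid.id)
next
  case (first a b)
  have "oriented_similarity (vector [b, 0]) (vector [a, 0]) \<circ> \<phi> 0 =
      oriented_similarity (vector [b, 0]) (vector [a * \<alpha>, 0])"
    by (simp add: koch_generators fun_eq_iff vec2_eq_iff oriented_similarity_components)
  then show ?case
    using ifs_monoid.comp[OF first(2) ifs_monoid.gen[of 0]] by simp
next
  case (last a b)
  have "oriented_similarity (vector [b, 0]) (vector [a, 0]) \<circ> \<phi> 3 =
      oriented_similarity (vector [b + a * \<delta>, 0]) (vector [a * (1 - \<delta>), 0])"
    by (simp add: koch_generators fun_eq_iff vec2_eq_iff oriented_similarity_components algebra_simps)
  then show ?case
    using ifs_monoid.comp[OF last(2) ifs_monoid.gen[of 3]] by simp
qed

text \<open>The origin is the fixed point of \<open>\<phi> 0\<close>, so iterates of any point of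
  the closed set \<open>Y\<close> converge to it.\<close>

lemma origin_in_attractor: "0 \<in> Y"
proof -
  obtain y where y: "y \<in> Y"
    using attractor by (auto simp: is_attractor_def)
  have "\<alpha> ^ n *\<^sub>R y \<in> Y" for n
  proof (induction n)
    case (Suc n)
    have "\<phi> 0 (\<alpha> ^ n *\<^sub>R y) \<in> Y"
      using ifs_monoid_attractor[OF attractor ifs_monoid.gen[of 0] Suc] by simp
    also have "\<phi> 0 (\<alpha> ^ n *\<^sub>R y) = \<alpha> ^ Suc n *\<^sub>R y"
      by (simp add: koch_generators vec2_eq_iff oriented_similarity_components)
    finally show ?case .
  qed (simp add: y)
  moreover have "(\<lambda>n. \<alpha> ^ n *\<^sub>R y) \<longlonglongrightarrow> 0 *\<^sub>R y"
    using ord by (intro tendsto_intros LIMSEQ_power_zero) simp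
  moreover have "closed Y"
    using attractor by (simp add: is_attractor_def compact_imp_closed)
  ultimately show ?thesis
    using closed_sequentially[of Y "\<lambda>n. \<alpha> ^ n *\<^sub>R y" 0] by simp
qed

lemma axis_part_subset_attractor:
  assumes "s \<in> axis_part \<alpha> \<delta>"
  shows "vector [s, 0] \<in> Y"
proof -
  \<comment> \<open>This vertex is the image of the origin under the second generator.\<close>
  have \<alpha>: "vector [\<alpha>, 0] \<in> Y"
  proof -
    have "\<phi> (Suc 0) 0 \<in> Y"
      using ifs_monoid_attractor[OF attractor ifs_monoid.gen[of "Suc 0"] origin_in_attractor] by simp
    also have "\<phi> (Suc 0) 0 = vector [\<alpha>, 0]"
      by (simp add: koch_generators vec2_eq_iff oriented_similarity_components)
    finally show ?thesis .
  qed
  consider a b where "axis_map \<alpha> \<delta> a b" "s = b" | a b where "axis_map \<alpha> \<delta> a b" "s = a * \<alpha> + b"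
    using assms by (auto simp: axis_part_def crossings_def)
  then show ?thesis
  proof cases
    case 1
    have "oriented_similarity (vector [b, 0]) (vector [a, 0]) 0 = vector [s, 0]"
      by (simp add: 1(2) vec2_eq_iff oriented_similarity_components)
    then show ?thesis
      using ifs_monoid_attractor[OF attractor axis_map_koch_maps[OF 1(1)] origin_in_attractor] by simp
  next
    case 2
    have "oriented_similarity (vector [b, 0]) (vector [a, 0]) (vector [\<alpha>, 0]) = vector [s, 0]"
      by (simp add: 2(2) vec2_eq_iff oriented_similarity_components)
    then show ?thesis
      using ifs_monoid_attractor[OF attractor axis_map_koch_maps[OF 2(1)] \<alpha>] by simp
  qed
qed

lemma infinite_crossings_in_open:
  assumes \<psi>: "\<psi> \<in> koch_maps" and "open U" "s \<in> axis_part \<alpha> \<delta>" "\<psi> (vector [s, 0]) \<in> U"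
  shows "infinite {t \<in> crossings \<alpha> \<delta>. \<psi> (vector [t, 0]) \<in> U}"
proof -
  obtain c d where "\<psi> = oriented_similarity c d"
    using koch_maps_similarity[OF \<psi>] by blast
  then have "open ((\<lambda>t. \<psi> (vector [t, 0])) -` U)"
    using assms(2) continuous_on_oriented_similarity_axis by (simp add: open_vimage)
  moreover have "s islimpt crossings \<alpha> \<delta>"
    using ord assms(3) by (intro islimpt_crossings) auto
  ultimately have "infinite ((\<lambda>t. \<psi> (vector [t, 0])) -` U \<inter> crossings \<alpha> \<delta>)"
    using assms(4) unfolding islimpt_eq_acc_point by auto
  also have "(\<lambda>t. \<psi> (vector [t, 0])) -` U \<inter> crossings \<alpha> \<delta> = {t \<in> crossings \<alpha> \<delta>. \<psi> (vector [t, 0]) \<in> U}"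
    by auto
  finally show ?thesis .
qed

text \<open>The slice \<open>C\<close> lies on a line of direction \<open>d\<close>. At each
  crossing a slice of direction \<open>e\<close>, independent of \<open>d\<close>, passes through
  it, and crossings are infinite in number near any point of \<open>C\<close>. If all of these were
  bad for \<open>g\<close>, then \<open>g\<close> would vanish on infinitely many parallel lines and
  so on the plane.\<close>

lemma hyperplane_family_koch_slices: "hyperplane_family Y koch_slices"
  unfolding hyperplane_family_def
proof (intro conjI ballI allI impI)
  fix C assume "C \<in> koch_slices"
  then obtain \<psi> where \<psi>: "\<psi> \<in> koch_maps" and C: "C = (\<lambda>t. \<psi> (vector [t, 0])) ` axis_part \<alpha> \<delta>"
    by (auto simp: koch_slices_def)
  obtain c d where \<psi>_eq: "\<psi> = oriented_similarity c d"
    and cd: "rational_vector c" "rational_vector d" "d \<noteq> 0"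
    using koch_maps_similarity[OF \<psi>] by blast
  show "C \<subseteq> Y"
    unfolding C using ifs_monoid_attractor[OF attractor \<psi>] axis_part_subset_attractor by auto
  show "\<exists>L. rational_hyperplane L \<and> C \<subseteq> L"
    unfolding C \<psi>_eq using rational_hyperplane_image_axis[OF cd] by blast
  fix U g
  assume "open U \<and> U \<inter> C \<noteq> {} \<and> real_polynomial_function g \<and> (\<exists>x :: real ^ 2. g x \<noteq> 0)"
  then have "open U" and "U \<inter> C \<noteq> {}" and g: "real_polynomial_function g"
    and g_nz: "\<exists>x :: real ^ 2. g x \<noteq> 0"
    by auto
  then obtain s0 where s0: "s0 \<in> axis_part \<alpha> \<delta>" "\<psi> (vector [s0, 0]) \<in> U"
    by (auto simp: C)
  define T where "T = {t \<in> crossings \<alpha> \<delta>. \<psi> (vector [t, 0]) \<in> U}"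
  have T: "infinite T"
    unfolding T_def by (rule infinite_crossings_in_open[OF \<psi> \<open>open U\<close> s0])
  \<comment> \<open>The second generator turns the axis into direction
    \<open>(\<beta> - \<alpha>, \<gamma>)\<close>; axis maps only rescale, so \<open>e\<close> is
    the same for all crossings.\<close>
  define e where "e = oriented_similarity 0 d (vector [\<beta> - \<alpha>, \<gamma>])"
  define D where "D a b = (\<lambda>s. (\<psi> \<circ> (oriented_similarity (vector [b, 0]) (vector [a, 0]) \<circ> \<phi> (Suc 0))) (vector [s, 0]))
      ` axis_part \<alpha> \<delta>" for a b
  have crossing: "(\<psi> \<circ> (oriented_similarity (vector [b, 0]) (vector [a, 0]) \<circ> \<phi> (Suc 0))) (vector [s, 0]) =
      (c + (a * \<alpha> + b) *\<^sub>R d) + (s * a) *\<^sub>R e" for a b s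
    by (simp add: \<psi>_eq koch_generators e_def vec2_eq_iff oriented_similarity_components algebra_simps)
  have D: "D a b \<in> koch_slices" "a > 0" if "axis_map \<alpha> \<delta> a b" for a b
  proof -
    have "oriented_similarity (vector [b, 0]) (vector [a, 0]) \<circ> \<phi> (Suc 0) \<in> koch_maps"
      using axis_map_koch_maps[OF that] by (intro ifs_monoid.comp ifs_monoid.gen) auto
    with \<psi> show "D a b \<in> koch_slices"
      unfolding D_def koch_slices_def using ifs_monoid.comp by blast
    show "a > 0"
      using that by induction (use ord in auto)
  qed
  have "\<exists>a b. axis_map \<alpha> \<delta> a b \<and> a * \<alpha> + b \<in> T \<and> zeros_nowhere_dense_in g (D a b)"
  proof (rule ccontr)
    assume *: "\<not> ?thesis"
    have line: "g ((c + t *\<^sub>R d) + u *\<^sub>R e) = 0" if "t \<in> T" for t u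
    proof -
      obtain a b where ab: "axis_map \<alpha> \<delta> a b" "t = a * \<alpha> + b"
        using \<open>t \<in> T\<close> by (auto simp: T_def crossings_def)
      let ?chi = "\<psi> \<circ> (oriented_similarity (vector [b, 0]) (vector [a, 0]) \<circ> \<phi> (Suc 0))"
      have "\<not> zeros_nowhere_dense_in g (D a b)"
        using * ab that by blast
      then obtain V s1 where V: "open V" "s1 \<in> axis_part \<alpha> \<delta>" "?chi (vector [s1, 0]) \<in> V"
        and zero: "\<And>y. y \<in> V \<inter> D a b \<Longrightarrow> g y = 0"
        unfolding zeros_nowhere_dense_in_def D_def by blast
      define S where "S = {s \<in> crossings \<alpha> \<delta>. ?chi (vector [s, 0]) \<in> V}"
      have chi: "?chi \<in> koch_maps"
        using \<psi> axis_map_koch_maps[OF ab(1)] by (intro ifs_monoid.comp ifs_monoid.gen) auto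
      have "infinite S"
        unfolding S_def by (rule infinite_crossings_in_open[OF chi, OF V])
      moreover have "g ((c + t *\<^sub>R d) + s *\<^sub>R (a *\<^sub>R e)) = 0" if "s \<in> S" for s
      proof -
        have "?chi (vector [s, 0]) \<in> V \<inter> D a b"
          using that crossings_subset_axis_part unfolding S_def D_def by blast
        from zero[OF this] show ?thesis
          unfolding crossing ab(2) by simp
      qed
      \<comment> \<open>Infinitely many zeros on the line through the crossing propagate to all of
        it; dividing by \<open>a\<close> undoes the scale of the slice.\<close>
      ultimately have "g ((c + t *\<^sub>R d) + (u / a) *\<^sub>R (a *\<^sub>R e)) = 0"
        by (rule real_polynomial_function_zero_on_line[OF g])
      then show ?thesis
        using D(2)[OF ab(1)] by simp
    qed
    \<comment> \<open>Now \<open>u\<close> is fixed and the zeros at parameters in \<open>T\<close>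
      propagate in direction \<open>d\<close>.\<close>
    have plane: "g (c + u *\<^sub>R e + t *\<^sub>R d) = 0" for t u
    proof (rule real_polynomial_function_zero_on_line[OF g T])
      fix t' assume "t' \<in> T"
      then have "g ((c + t' *\<^sub>R d) + u *\<^sub>R e) = 0"
        by (rule line)
      then show "g (c + u *\<^sub>R e + t' *\<^sub>R d) = 0"
        by (simp only: add_ac)
    qed
    have "g q = 0" for q
    proof -
      obtain p where "oriented_similarity c d p = q"
        using surj_oriented_similarity[OF cd(3)] by blast
      \<comment> \<open>Since \<gamma> is nonzero, \<open>(\<beta> - \<alpha>, \<gamma>)\<close> and
        \<open>(1, 0)\<close> form a basis; \<open>u\<close> is the first coefficient of
        \<open>p\<close> in it.\<close>
      moreover define u where "u = p $ 2 / \<gamma>"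
      have "p $ 2 = u * \<gamma>"
        using ord(5) by (simp add: u_def)
      ultimately have "q = c + u *\<^sub>R e + (p $ 1 - u * (\<beta> - \<alpha>)) *\<^sub>R d"
        by (auto simp: e_def vec2_eq_iff oriented_similarity_components algebra_simps)
      then show ?thesis
        using plane by simp
    qed
    with g_nz show False by blast
  qed
  then obtain a b where ab: "axis_map \<alpha> \<delta> a b" "a * \<alpha> + b \<in> T" "zeros_nowhere_dense_in g (D a b)"
    by blast
  \<comment> \<open>Parameter \<open>0\<close> of the new slice gives the crossing itself, which
    also lies on \<open>C\<close> and in \<open>U\<close>.\<close>
  have "0 \<in> axis_part \<alpha> \<delta>"
    using axis_map.id by (auto simp: axis_part_def)
  then have "(\<psi> \<circ> (oriented_similarity (vector [b, 0]) (vector [a, 0]) \<circ> \<phi> (Suc 0))) (vector [0, 0]) \<in> D a b"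
    unfolding D_def by (rule imageI)
  then have "c + (a * \<alpha> + b) *\<^sub>R d \<in> D a b"
    unfolding crossing by simp
  then have "\<psi> (vector [a * \<alpha> + b, 0]) \<in> D a b"
    by (simp add: \<psi>_eq oriented_similarity_on_axis)
  moreover have "\<psi> (vector [a * \<alpha> + b, 0]) \<in> U" "\<psi> (vector [a * \<alpha> + b, 0]) \<in> C"
    using ab(2) crossings_subset_axis_part by (auto simp: T_def C)
  ultimately have "U \<inter> C \<inter> D a b \<noteq> {}"
    by blast
  then show "\<exists>C'\<in>koch_slices. U \<inter> C \<inter> C' \<noteq> {} \<and> zeros_nowhere_dense_in g C'"
    using D(1)[OF ab(1)] ab(3) by (intro bexI[of _ "D a b"] conjI)
qed

lemma closure_koch_slices: "Y \<subseteq> closure (\<Union>koch_slices)"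
proof -
  have "0 \<in> axis_part \<alpha> \<delta>"
    using axis_map.id by (auto simp: axis_part_def)
  then have "{\<psi> (vector [0, 0]) | \<psi>. \<psi> \<in> koch_maps} \<subseteq> \<Union>koch_slices"
    unfolding koch_slices_def by blast
  then have "closure {\<psi> (vector [0, 0]) | \<psi>. \<psi> \<in> koch_maps} \<subseteq> closure (\<Union>koch_slices)"
    by (rule closure_mono)
  moreover have "Y \<subseteq> closure {\<psi> (vector [0, 0]) | \<psi>. \<psi> \<in> koch_maps}"
    using contracting by (intro ifs_monoid_orbit_dense[OF attractor]) auto
  ultimately show ?thesis
    by (rule order.trans[rotated])
qed

end

section \<open>Both cases combined\<close>

theorem theorem5p2:
  fixes f :: "nat \<Rightarrow> real \<Rightarrow> real"
  assumes pos: "\<And>k t. k \<ge> 1 \<Longrightarrow> t > 0 \<Longrightarrow> f k t > 0"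
    and noninc: "\<And>k. k \<ge> 1 \<Longrightarrow> antimono_on {0<..} (f k)"
  shows
    "(\<forall>(Ys :: 'n::finite \<Rightarrow> real set) (i :: 'n) (j :: 'n) (Y :: (real ^ 'n) set).
        i \<noteq> j \<and> (\<forall>l. perfect_set (Ys l) \<and> Ys l \<noteq> {}) \<and>
        (\<forall>l\<in>{i, j}. Ys l \<subseteq> closure (\<rat> \<inter> Ys l)) \<and>
        Y = {x. \<forall>l. x $ l \<in> Ys l} \<longrightarrow>
        has_dense_uncountable_subset Y
          (\<lambda>x. \<not> algebraic_vector x \<and> (\<forall>k\<ge>1. uniform_of_degree (f k) k x)) \<and>
        has_dense_uncountable_subset Y
          (\<lambda>x. \<not> algebraic_vector x \<and> (\<forall>k\<ge>1. singular_of_degree k x)))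
   \<and> (\<forall>Y :: (real ^ 2) set.
        rational_koch_snowflake Y \<longrightarrow>
        has_dense_uncountable_subset Y
          (\<lambda>x. \<not> algebraic_vector x \<and> (\<forall>k\<ge>1. uniform_of_degree (f k) k x)) \<and>
        has_dense_uncountable_subset Y
          (\<lambda>x. \<not> algebraic_vector x \<and> (\<forall>k\<ge>1. singular_of_degree k x)))"
proof (intro conjI allI impI; (elim conjE)?)
  fix Ys :: "'n \<Rightarrow> real set" and i j :: 'n and Y :: "(real ^ 'n) set"
  assume ij: "i \<noteq> j" and Ys: "\<forall>l. perfect_set (Ys l) \<and> Ys l \<noteq> {}"
    and rational: "\<forall>l\<in>{i, j}. Ys l \<subseteq> closure (\<rat> \<inter> Ys l)"
    and Y: "Y = {x. \<forall>l. x $ l \<in> Ys l}"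
  have "(\<chi> l. SOME y. y \<in> Ys l) \<in> Y"
    using Ys by (simp add: Y some_in_eq)
  then have "Y \<noteq> {}" by blast
  note perfect = Ys[rule_format, THEN conjunct1]
  have prems: "closed Y" "hyperplane_family Y (coordinate_slices i j Y)"
      "Y \<subseteq> closure (\<Union>(coordinate_slices i j Y))"
    using closed_product_perfect_sets[of Ys, OF perfect]
      hyperplane_family_coordinate_slices[OF perfect Y rational[rule_format] ij]
      closure_coordinate_slices[OF perfect Y rational[rule_format]]
    by (simp_all add: Y)
  show "has_dense_uncountable_subset Y
      (\<lambda>x. \<not> algebraic_vector x \<and> (\<forall>k\<ge>1. uniform_of_degree (f k) k x))"
    by (rule dense_uncountable_uniform[OF pos noninc prems(1) \<open>Y \<noteq> {}\<close> prems(2,3)])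
  show "has_dense_uncountable_subset Y
      (\<lambda>x. \<not> algebraic_vector x \<and> (\<forall>k\<ge>1. singular_of_degree k x))"
    by (rule dense_uncountable_singular[OF prems(1) \<open>Y \<noteq> {}\<close> prems(2,3)])
next
  fix Y :: "(real ^ 2) set"
  assume "rational_koch_snowflake Y"
  then obtain \<alpha> \<beta> \<gamma> \<delta> \<phi> where koch:
      "\<alpha> \<in> \<rat>" "\<beta> \<in> \<rat>" "\<gamma> \<in> \<rat>" "\<delta> \<in> \<rat>"
      "0 < \<alpha>" "\<alpha> < \<beta>" "\<beta> < \<delta>" "\<delta> < 1" "0 < \<gamma>"
      "\<And>i. i < 4 \<Longrightarrow> contracting_similarity (\<phi> i)"
      "\<And>i. i < 4 \<Longrightarrow> orientation_preserving (\<phi> i)"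
      "\<And>i. i < 4 \<Longrightarrow> \<phi> i (vector [0, 0]) = koch_vertices \<alpha> \<beta> \<gamma> \<delta> ! i"
      "\<And>i. i < 4 \<Longrightarrow> \<phi> i (vector [1, 0]) = koch_vertices \<alpha> \<beta> \<gamma> \<delta> ! Suc i"
      "is_attractor {..<4} \<phi> Y"
    unfolding rational_koch_snowflake_def by blast
  then have Y: "closed Y" "Y \<noteq> {}"
    by (auto simp: is_attractor_def compact_imp_closed)
  note family = hyperplane_family_koch_slices[OF koch] closure_koch_slices[OF koch]
  show "has_dense_uncountable_subset Y
      (\<lambda>x. \<not> algebraic_vector x \<and> (\<forall>k\<ge>1. uniform_of_degree (f k) k x))"
    by (rule dense_uncountable_uniform[OF pos noninc Y family])
  show "has_dense_uncountable_subset Y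
      (\<lambda>x. \<not> algebraic_vector x \<and> (\<forall>k\<ge>1. singular_of_degree k x))"
    by (rule dense_uncountable_singular[OF Y family])
qed

end
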